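(* Let $X = Y$ and $S$ be completely regular topological spaces, and let $\pi^{+} \in \mathcal M_{+}(X \times S)$ and $\pi^{-}\in \mathcal M_{+}(Y \times S)$ be nonnegative Radon measures. Then $$\max_{\gamma\in\Gamma(\pi^{+},\pi^{-})}\gamma(X\times Y\times S)=\max_{(\sigma^{+},\sigma^{-})}\sigma^{+}(X\times S),$$ where the maximum on the right is taken over all admissible pairs $(\sigma^{+},\sigma^{-})$. Moreover, for every admissible pair $(\sigma^+, \sigma^{-})$ that is optimal for the right-hand problem there exists $\gamma\in\Gamma(\pi^{+},\pi^{-})$, optimal for the left-hand problem, such that $Pr_{X \times S}(\gamma) = \sigma^{+}$ and $Pr_{Y \times S}(\gamma) = \sigma^{-}$.
   Context: For a topological space $Z$, $\mathcal M_{+}(Z)$ denotes the set of finite nonnegative Radon measures on $Z$: Borel measures $\mu$ such that for every Borel set $B$ and every $\varepsilon>0$ there is a compact set $K\subset B$ with $\mu(B\setminus K)<\varepsilon$. $Pr$ with a subscript denotes the projection (image measure) of a measure on the indicated factors. Inequalities between measures are setwise on Borel sets. $Y$ is a copy of $X$. $\Gamma(\pi^{+}, \pi^{-})$ is the set of all $\gamma \in \mathcal M_{+}(X \times Y \times S)$ such that $Pr_{X \times S}(\gamma) \le \pi^{+}$, $Pr_{Y \times S}(\gamma) \le \pi^{-}$, and $Pr_X(\gamma)=Pr_Y(\gamma)$ (as measures on $X=Y$). This is the admissible set of the optimal exchange problem with unit cost. A pair $(\sigma^{+},\sigma^{-})$ with $\sigma^{+} \in \mathcal M_{+}(X \times S)$,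 $\sigma^{-} \in \mathcal M_{+}(Y \times S)$ is admissible if $\sigma^{+} \le \pi^{+}$, $\sigma^{-} \le \pi^{-}$, $Pr_{X}(\sigma^{+}) = Pr_{Y}(\sigma^{-})$ and $Pr_{S}(\sigma^{+}) = Pr_{S}(\sigma^{-})$. *)

theory Defs
  imports "HOL-Analysis.Analysis"
begin

(* The spaces X = Y and S are the types 'x and 's. All measures live on the Borel
   sigma-algebra of the product topology on the product types. For spaces that are not
   second countable this can be larger than the product of the Borel sigma-algebras.
   The coordinate projections are continuous, hence Borel measurable, so distr along
   them is the image measure. *)

(* Complete regularity is not taken to include the Hausdorff property, so a compact set
   need not be Borel and K must be required to be. In Hausdorff spaces that requirement
   is automatic. *)
definition radon_measures :: "'a::topological_space measure set" where
  "radon_measures =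
     {\<mu>. sets \<mu> = sets borel \<and> finite_measure \<mu> \<and>
          (\<forall>B\<in>sets borel. \<forall>\<epsilon>>0. \<exists>K. compact K \<and> K \<in> sets borel \<and> K \<subseteq> B \<and>
             measure \<mu> (B - K) < \<epsilon>)}"

definition borel_le :: "'a::topological_space measure \<Rightarrow> 'a measure \<Rightarrow> bool" where
  "borel_le \<mu> \<nu> \<longleftrightarrow> (\<forall>B\<in>sets borel. emeasure \<mu> B \<le> emeasure \<nu> B)"

definition exchange_plans ::
    "('x::topological_space \<times> 's::topological_space) measure \<Rightarrow> ('x \<times> 's) measure
      \<Rightarrow> ('x \<times> 'x \<times> 's) measure set" where
  "exchange_plans \<pi>p \<pi>m =
     {\<gamma>\<in>radon_measures.
        borel_le (distr \<gamma> borel (\<lambda>(x, y, s). (x, s))) \<pi>p \<and>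
        borel_le (distr \<gamma> borel (\<lambda>(x, y, s). (y, s))) \<pi>m \<and>
        distr \<gamma> borel (\<lambda>(x, y, s). x) = distr \<gamma> borel (\<lambda>(x, y, s). y)}"

definition admissible_pairs ::
    "('x::topological_space \<times> 's::topological_space) measure \<Rightarrow> ('x \<times> 's) measure
      \<Rightarrow> (('x \<times> 's) measure \<times> ('x \<times> 's) measure) set" where
  "admissible_pairs \<pi>p \<pi>m =
     {(\<sigma>p, \<sigma>m). \<sigma>p \<in> radon_measures \<and> \<sigma>m \<in> radon_measures \<and>
        borel_le \<sigma>p \<pi>p \<and> borel_le \<sigma>m \<pi>m \<and>
        distr \<sigma>p borel fst = distr \<sigma>m borel fst \<and>
        distr \<sigma>p borel snd = distr \<sigma>m borel snd}"

definition optimal_plan ::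
    "('x::topological_space \<times> 's::topological_space) measure \<Rightarrow> ('x \<times> 's) measure
      \<Rightarrow> ('x \<times> 'x \<times> 's) measure \<Rightarrow> bool" where
  "optimal_plan \<pi>p \<pi>m \<gamma> \<longleftrightarrow>
     is_arg_max (\<lambda>\<gamma>'. measure \<gamma>' UNIV) (\<lambda>\<gamma>'. \<gamma>' \<in> exchange_plans \<pi>p \<pi>m) \<gamma>"

definition optimal_pair ::
    "('x::topological_space \<times> 's::topological_space) measure \<Rightarrow> ('x \<times> 's) measure
      \<Rightarrow> ('x \<times> 's) measure \<Rightarrow> ('x \<times> 's) measure \<Rightarrow> bool" where
  "optimal_pair \<pi>p \<pi>m \<sigma>p \<sigma>m \<longleftrightarrow>
     is_arg_max (\<lambda>(\<tau>p, \<tau>m). measure \<tau>p UNIV) (\<lambda>\<tau>. \<tau> \<in> admissible_pairs \<pi>p \<pi>m) (\<sigma>p, \<sigma>m)"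

end

theory Submission
  imports Defs
begin

text \<open>The marginals of an exchange plan form an admissible pair of the same mass. Conversely, the two
  members of an admissible pair have a common marginal on \<open>S\<close> and can be glued along it: on a finite
  Borel partition the gluing is the one that makes \<open>X\<close> and \<open>Y\<close> conditionally independent given \<open>S\<close>,
  and Tychonoff's theorem yields a finitely additive charge on all subsets of \<open>X \<times> Y \<times> S\<close> that has
  the right values on all Borel rectangles. The charge is tight, so Halmos's content construction turns
  it into a Radon measure that it dominates on open sets. Since no mass is lost, the
  marginals remain the prescribed ones. Hence the two problems have the same value, and optimal pairs
  lift to optimal plans. An optimal pair exists because the admissible pairs, as set functions, form a
  Tychonoff-compact set: an additive set function dominated by a Radon measure is itself a Radon
  measure.\<close>

section \<open>Radon measures on regular spaces\<close>

text \<open>Two obstacles shape the proof. First, without countability assumptions the Borel sets of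
  a product need not be generated by rectangles, and gluing by regular conditional measures would
  call for a disintegration whose existence is delicate. So only finite partitions are glued by a
  formula. The limit exists because a charge on all subsets is just a point of a product of compact
  intervals, and every constraint is a closed condition there. The price is countable additivity.
  Restoring it may lower the values on open sets, but tightness, inherited from the two marginals,
  protects the total mass; and two Radon measures of equal mass, one of which is below the other on
  open sets, coincide by passing to complements. Second, without the Hausdorff property compact sets
  need not be closed or Borel. Regularity repairs this: the closure of a compact set is compact and
  does not leave any open or Borel set that contains the compact set.\<close>

lemma regular_separation:
  fixes K C :: "'a::topological_space set"
  assumes "regular_space (euclidean :: 'a topology)" "compact K" "closed C" "K \<inter> C = {}"
  obtains U V where "open U" "open V" "K \<subseteq> U" "C \<subseteq> V" "U \<inter> V = {}"
  using regular_space_compact_closed_separation[OF assms(1), of K C] assms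
  by (auto simp: disjnt_def)

lemma regular_closure_compact_subset_open:
  fixes K U :: "'a::topological_space set"
  assumes "regular_space (euclidean :: 'a topology)" "compact K" "open U" "K \<subseteq> U"
  shows "closure K \<subseteq> U"
proof -
  obtain V W where "open V" "open W" "K \<subseteq> V" "- U \<subseteq> W" "V \<inter> W = {}"
    using regular_separation[OF assms(1,2), of "- U"] assms by auto
  then have "closure K \<subseteq> - W"
    by (intro closure_minimal) auto
  with \<open>- U \<subseteq> W\<close> show ?thesis by auto
qed

text \<open>A finite subcover of \<open>K\<close> has an open union around \<open>K\<close>, and in
  a regular space such a union already contains the closure.\<close>

lemma regular_compact_closure:
  fixes K :: "'a::topological_space set"
  assumes "regular_space (euclidean :: 'a topology)" "compact K"
  shows "compact (closure K)"
proof (rule compactI)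
  fix \<C> assume "\<forall>t\<in>\<C>. open t" "closure K \<subseteq> \<Union>\<C>"
  moreover have "K \<subseteq> closure K" by (rule closure_subset)
  ultimately obtain \<D> where \<D>: "\<D> \<subseteq> \<C>" "finite \<D>" "K \<subseteq> \<Union>\<D>"
    using compactE[OF assms(2), of \<C>] by (metis subset_trans)
  then have "open (\<Union>\<D>)" using \<open>\<forall>t\<in>\<C>. open t\<close> by blast
  then have "closure K \<subseteq> \<Union>\<D>"
    using regular_closure_compact_subset_open[OF assms] \<D>(3) by blast
  with \<D> show "\<exists>\<D>\<subseteq>\<C>. finite \<D> \<and> closure K \<subseteq> \<Union>\<D>" by blast
qed

text \<open>A compact Borel set need not be closed in a space that is not Hausdorff. In a regular space it is,
  because Borel sets do not separate topologically indistinguishable points.\<close>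

lemma borel_indistinguishable:
  fixes x y :: "'a::topological_space"
  assumes "B \<in> sets borel" "\<And>U. open U \<Longrightarrow> x \<in> U \<longleftrightarrow> y \<in> U"
  shows "x \<in> B \<longleftrightarrow> y \<in> B"
proof -
  have "B \<in> sigma_sets UNIV {S. open S}"
    using assms(1) by (simp add: borel_def)
  then show ?thesis
    by induction (use assms(2) in auto)
qed

lemma regular_closure_compact_subset_borel:
  fixes K B :: "'a::topological_space set"
  assumes reg: "regular_space (euclidean :: 'a topology)" and K: "compact K"
    and B: "B \<in> sets borel" "K \<subseteq> B"
  shows "closure K \<subseteq> B"
proof
  fix z assume z: "z \<in> closure K"
  show "z \<in> B"
  proof (rule ccontr)
    assume "z \<notin> B"
    \<comment> \<open>Some open set contains exactly one of \<open>k\<close> and \<open>z\<close>,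
      but not necessarily \<open>k\<close>. Regularity makes the separation symmetric, whence the
      two cases.\<close>
    have "\<exists>V. open V \<and> k \<in> V \<and> z \<notin> closure V" if "k \<in> K" for k
    proof -
      from that B \<open>z \<notin> B\<close> obtain U where U: "open U" "(k \<in> U) \<noteq> (z \<in> U)"
        using borel_indistinguishable[OF B(1), of k z] by blast
      have "\<exists>V W. open V \<and> open W \<and> k \<in> V \<and> z \<in> W \<and> V \<inter> W = {}"
      proof (cases "k \<in> U")
        case True
        obtain V W where "open V" "open W" "{k} \<subseteq> V" "- U \<subseteq> W" "V \<inter> W = {}"
          by (rule regular_separation[OF reg, of "{k}" "- U"]) (use U True in auto)
        with U True show ?thesis by blast
      next
        case False
        obtain V W where "open V" "open W" "{z} \<subseteq> V" "- U \<subseteq> W" "V \<inter> W = {}"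
          by (rule regular_separation[OF reg, of "{z}" "- U"]) (use U False in auto)
        with U False show ?thesis by blast
      qed
      then obtain V W where VW: "open V" "open W" "k \<in> V" "z \<in> W" "V \<inter> W = {}" by blast
      then have "closure V \<subseteq> - W" by (intro closure_minimal) auto
      with VW show ?thesis by blast
    qed
    then obtain V where V: "\<And>k. k \<in> K \<Longrightarrow> open (V k) \<and> k \<in> V k \<and> z \<notin> closure (V k)"
      by metis
    obtain F where F: "F \<subseteq> K" "finite F" "K \<subseteq> (\<Union>k\<in>F. V k)"
      using compactE_image[OF K, of K V] V by blast
    have "closure K \<subseteq> (\<Union>k\<in>F. closure (V k))"
    proof (rule closure_minimal)
      show "K \<subseteq> (\<Union>k\<in>F. closure (V k))"
        using F(3) closure_subset by (meson UN_mono order_trans subset_refl)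
      show "closed (\<Union>k\<in>F. closure (V k))"
        using F(2) by blast
    qed
    then show False using z V F(1) by blast
  qed
qed

section \<open>Closed compact witnesses, images and minorants of Radon measures\<close>

lemma radon_measures_sets: "\<mu> \<in> radon_measures \<Longrightarrow> sets \<mu> = sets borel"
  and radon_measures_finite: "\<mu> \<in> radon_measures \<Longrightarrow> finite_measure \<mu>"
  by (auto simp: radon_measures_def)

lemma radon_measures_space: "\<mu> \<in> radon_measures \<Longrightarrow> space \<mu> = UNIV"
  by (metis radon_measures_sets sets_eq_imp_space_eq space_borel)

lemma radon_measures_compact:
  assumes "\<mu> \<in> radon_measures" "B \<in> sets borel" "\<epsilon> > 0"
  obtains K where "compact K" "K \<in> sets borel" "K \<subseteq> B" "measure \<mu> (B - K) < \<epsilon>"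
proof -
  have "\<exists>K. compact K \<and> K \<in> sets borel \<and> K \<subseteq> B \<and> measure \<mu> (B - K) < \<epsilon>"
    using assms by (simp add: radon_measures_def)
  with that show thesis by blast
qed

text \<open>Allowing a non-Borel \<open>K\<close> matters for direct images of compact sets. The
  closure of \<open>K\<close> serves as the Borel witness: it is compact by regularity and stays
  inside the Borel set \<open>B\<close>.\<close>

lemma radon_measuresI:
  fixes \<mu> :: "'a::topological_space measure"
  assumes reg: "regular_space (euclidean :: 'a topology)"
    and \<mu>: "sets \<mu> = sets borel" "finite_measure \<mu>"
    and K: "\<And>B \<epsilon>. B \<in> sets borel \<Longrightarrow> \<epsilon> > 0 \<Longrightarrow> \<exists>K. compact K \<and> K \<subseteq> B \<and> measure \<mu> (B - closure K) < \<epsilon>"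
  shows "\<mu> \<in> radon_measures"
  unfolding radon_measures_def
proof (intro CollectI conjI ballI allI impI)
  fix B :: "'a set" and \<epsilon> :: real assume B: "B \<in> sets borel" "\<epsilon> > 0"
  then obtain K where "compact K" "K \<subseteq> B" "measure \<mu> (B - closure K) < \<epsilon>"
    using K by blast
  then show "\<exists>K. compact K \<and> K \<in> sets borel \<and> K \<subseteq> B \<and> measure \<mu> (B - K) < \<epsilon>"
    using B regular_compact_closure[OF reg] regular_closure_compact_subset_borel[OF reg]
    by (intro exI[of _ "closure K"]) auto
qed (use \<mu> in auto)

lemma radon_measures_closed_compact:
  fixes \<mu> :: "'a::topological_space measure"
  assumes reg: "regular_space (euclidean :: 'a topology)"
    and \<mu>: "\<mu> \<in> radon_measures" and B: "B \<in> sets borel" "\<epsilon> > 0"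
  obtains K where "compact K" "closed K" "K \<subseteq> B" "measure \<mu> (B - K) < \<epsilon>"
proof -
  obtain K where K: "compact K" "K \<in> sets borel" "K \<subseteq> B" "measure \<mu> (B - K) < \<epsilon>"
    using radon_measures_compact[OF \<mu> B] .
  then have "closure K = K"
    using regular_closure_compact_subset_borel[OF reg K(1,2)] closure_subset by auto
  with K show thesis by (metis that closed_closure)
qed

lemma radon_measures_distr:
  fixes \<mu> :: "'a::topological_space measure" and f :: "'a \<Rightarrow> 'b::topological_space"
  assumes reg: "regular_space (euclidean :: 'b topology)"
    and \<mu>: "\<mu> \<in> radon_measures" and f: "continuous_on UNIV f"
  shows "distr \<mu> borel f \<in> radon_measures"
proof -
  note [measurable_cong] = radon_measures_sets[OF \<mu>]
  have [measurable]: "f \<in> borel_measurable borel"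
    by (rule borel_measurable_continuous_onI[OF f])
  have sp: "space \<mu> = UNIV" by (rule radon_measures_space[OF \<mu>])
  interpret finite_measure \<mu> by (rule radon_measures_finite[OF \<mu>])
  show ?thesis
  proof (rule radon_measuresI[OF reg])
    show "finite_measure (distr \<mu> borel f)" by (rule finite_measure_distr) measurable
    fix B :: "'b set" and \<epsilon> :: real assume [measurable]: "B \<in> sets borel" and "\<epsilon> > 0"
    then have B': "f -` B \<in> sets borel" using measurable_sets[of f borel borel B] by simp
    from radon_measures_compact[OF \<mu> this \<open>\<epsilon> > 0\<close>] obtain K
      where K: "compact K" "K \<in> sets borel" "K \<subseteq> f -` B" "measure \<mu> (f -` B - K) < \<epsilon>" .
    have "measure (distr \<mu> borel f) (B - closure (f ` K)) = measure \<mu> (f -` (B - closure (f ` K)))"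
      by (subst measure_distr) (auto simp: sp)
    also have "\<dots> \<le> measure \<mu> (f -` B - K)"
      using K(2) B' closure_subset[of "f ` K"]
      by (intro finite_measure_mono) (auto simp: radon_measures_sets[OF \<mu>])
    finally have "measure (distr \<mu> borel f) (B - closure (f ` K)) < \<epsilon>" using K by simp
    moreover have "compact (f ` K)"
      using K(1) f by (meson compact_continuous_image continuous_on_subset subset_UNIV)
    ultimately show "\<exists>K. compact K \<and> K \<subseteq> B \<and> measure (distr \<mu> borel f) (B - closure K) < \<epsilon>"
      using K(3) by (intro exI[of _ "f ` K"]) auto
  qed auto
qed

lemma radon_measures_borel_le:
  fixes \<mu> \<nu> :: "'a::topological_space measure"
  assumes \<nu>: "\<nu> \<in> radon_measures" and s: "sets \<mu> = sets borel" and le: "borel_le \<mu> \<nu>"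
  shows "\<mu> \<in> radon_measures"
proof -
  interpret N: finite_measure \<nu> by (rule radon_measures_finite[OF \<nu>])
  have m: "measure \<mu> B \<le> measure \<nu> B" if "B \<in> sets borel" for B
    using le that by (simp add: borel_le_def measure_def enn2real_mono N.emeasure_finite less_top[symmetric])
  have "emeasure \<mu> (space \<mu>) \<le> emeasure \<nu> UNIV"
    using le s by (auto simp: borel_le_def sets_eq_imp_space_eq)
  then have "finite_measure \<mu>"
    by (intro finite_measureI) (metis N.emeasure_finite infinity_ennreal_def neq_top_trans)
  then show ?thesis using \<nu> s m unfolding radon_measures_def
    by (auto, meson sets.Diff order_le_less_trans)
qed

section \<open>From tight charges to Radon measures\<close>

text \<open>\<open>K - U\<close> and \<open>K - V\<close> are disjoint because \<open>K\<close> is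
  covered. Cutting away disjoint open sets around them, one at a time, leaves two pieces, and no
  point of \<open>K\<close> is cut away twice.\<close>

lemma regular_compact_split:
  fixes K U V :: "'a::topological_space set"
  assumes reg: "regular_space (euclidean :: 'a topology)"
    and K: "compact K" "closed K" and UV: "open U" "open V" "K \<subseteq> U \<union> V"
  obtains K1 K2 where "compact K1" "closed K1" "K1 \<subseteq> U" "compact K2" "closed K2" "K2 \<subseteq> V" "K = K1 \<union> K2"
proof -
  obtain P Q where PQ: "open P" "open Q" "K - U \<subseteq> P" "K - V \<subseteq> Q" "P \<inter> Q = {}"
  proof (rule regular_separation[OF reg, of "K - U" "K - V"])
    show "compact (K - U)" by (rule compact_diff) (use K UV in auto)
    show "closed (K - V)" by (rule closed_Diff) (use K UV in auto)
  qed (use UV in auto)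
  show thesis
  proof (rule that[of "K - P" "K - Q"])
    show "compact (K - P)" "compact (K - Q)" by (rule compact_diff; use K PQ in auto)+
    show "closed (K - P)" "closed (K - Q)" by (rule closed_Diff; use K PQ in auto)+
  qed (use PQ in auto)
qed

text \<open>The charge is defined on all subsets since it arises as a point of a product space
  indexed by the power set. It is only finitely additive; \<open>tight\<close> keeps mass from
  escaping when countable additivity is enforced.\<close>

locale tight_charge =
  fixes l :: "'a::topological_space set \<Rightarrow> real"
  assumes regular: "regular_space (euclidean :: 'a topology)"
    and nonneg: "0 \<le> l A"
    and add: "A \<inter> B = {} \<Longrightarrow> l (A \<union> B) = l A + l B"
    and tight: "\<epsilon> > 0 \<Longrightarrow> \<exists>K. compact K \<and> l (- K) \<le> \<epsilon>"
begin

text \<open>The outer regularisation of \<open>l\<close>, used on compact sets. It lies above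
  \<open>l K\<close> and below \<open>l U\<close> for open \<open>U \<supseteq> K\<close>: the lower
  bound preserves the total mass, the upper bound yields domination by \<open>l\<close> on open
  sets.\<close>

definition content :: "'a set \<Rightarrow> ennreal" where
  "content K = (INF U\<in>{U. open U \<and> K \<subseteq> U}. ennreal (l U))"

text \<open>Closedness is requested separately because compact sets need not be closed. It keeps
  \<open>V - K\<close> open for open \<open>V\<close>, as the Caratheodory argument
  requires.\<close>

definition inner_content :: "'a set \<Rightarrow> ennreal" where
  "inner_content U = (SUP K\<in>{K. compact K \<and> closed K \<and> K \<subseteq> U}. content K)"

definition outer :: "'a set \<Rightarrow> ennreal" where
  "outer E = (INF U\<in>{U. open U \<and> E \<subseteq> U}. inner_content U)"

lemma mono: "A \<subseteq> B \<Longrightarrow> l A \<le> l B"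
  using add[of A "B - A"] nonneg[of "B - A"] by (simp add: Un_absorb1)

lemma empty: "l {} = 0"
  using add[of "{}" "{}"] by simp

lemma content_mono: "K \<subseteq> L \<Longrightarrow> content K \<le> content L"
  unfolding content_def by (rule INF_superset_mono) auto

lemma content_le: "open U \<Longrightarrow> K \<subseteq> U \<Longrightarrow> content K \<le> l U"
  unfolding content_def by (rule INF_lower) auto

lemma le_content: "ennreal (l K) \<le> content K"
  unfolding content_def by (rule INF_greatest) (auto intro!: ennreal_leI mono)

lemma content_finite: "content K < top"
  using content_le[of UNIV K] by (simp add: le_less_trans)

lemma content_approx:
  assumes "e > 0"
  obtains U where "open U" "K \<subseteq> U" "ennreal (l U) \<le> content K + ennreal e"
proof -
  have "content K < content K + ennreal e"
    using content_finite[of K] assms by (cases "content K") (auto simp: ennreal_plus[symmetric] ennreal_less_iff simp del: ennreal_plus)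
  then obtain U where "open U" "K \<subseteq> U" "ennreal (l U) < content K + ennreal e"
    unfolding content_def[of K] INF_less_iff by auto
  then show thesis by (intro that) auto
qed

lemma content_Un_le: "content (K \<union> L) \<le> content K + content L"
proof (rule ennreal_le_epsilon)
  fix e :: real assume e: "0 < e"
  obtain U where U: "open U" "K \<subseteq> U" "ennreal (l U) \<le> content K + ennreal (e/2)"
    using content_approx[of "e/2"] e by auto
  obtain V where V: "open V" "L \<subseteq> V" "ennreal (l V) \<le> content L + ennreal (e/2)"
    using content_approx[of "e/2"] e by auto
  have "l (U \<union> V) \<le> l U + l V"
    using add[of U "V - U"] mono[of "V - U" V] by simp
  then have "ennreal (l (U \<union> V)) \<le> ennreal (l U) + ennreal (l V)"
    using nonneg by (metis ennreal_leI ennreal_plus)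
  moreover have "content (K \<union> L) \<le> ennreal (l (U \<union> V))"
    using U V by (intro content_le) auto
  ultimately have "content (K \<union> L) \<le> ennreal (l U) + ennreal (l V)" by order
  also have "\<dots> \<le> (content K + ennreal (e/2)) + (content L + ennreal (e/2))"
    by (intro add_mono U V)
  also have "\<dots> = content K + content L + (ennreal (e/2) + ennreal (e/2))"
    by (simp add: ac_simps)
  also have "ennreal (e/2) + ennreal (e/2) = ennreal e"
    using e by (simp add: ennreal_plus[symmetric] del: ennreal_plus)
  finally show "content (K \<union> L) \<le> content K + content L + ennreal e" .
qed

text \<open>Disjoint \<open>K\<close> and \<open>L\<close> have disjoint open neighbourhoods, so
  finite additivity of \<open>l\<close> applies inside every open set around both.\<close>

lemma content_disjoint_le:
  assumes "compact K" "closed L" "K \<inter> L = {}"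
  shows "content K + content L \<le> content (K \<union> L)"
  unfolding content_def[of "K \<union> L"]
proof (rule INF_greatest)
  fix U assume "U \<in> {U. open U \<and> K \<union> L \<subseteq> U}"
  then have U: "open U" "K \<subseteq> U" "L \<subseteq> U" by auto
  obtain P Q where PQ: "open P" "open Q" "K \<subseteq> P" "L \<subseteq> Q" "P \<inter> Q = {}"
    using regular_separation[OF regular assms] .
  have "content K + content L \<le> ennreal (l (U \<inter> P)) + ennreal (l (U \<inter> Q))"
    using U PQ by (intro add_mono content_le) auto
  also have "\<dots> = ennreal (l (U \<inter> P \<union> U \<inter> Q))"
    using PQ nonneg by (subst add) (auto simp: ennreal_plus)
  also have "\<dots> \<le> ennreal (l U)"
    by (intro ennreal_leI mono) auto
  finally show "content K + content L \<le> ennreal (l U)" .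
qed

section \<open>The inner content of open sets\<close>

lemma inner_content_mono: "U \<subseteq> V \<Longrightarrow> inner_content U \<le> inner_content V"
  unfolding inner_content_def by (rule SUP_subset_mono) auto

lemma content_le_inner_content: "compact K \<Longrightarrow> closed K \<Longrightarrow> K \<subseteq> U \<Longrightarrow> content K \<le> inner_content U"
  unfolding inner_content_def by (rule SUP_upper) auto

lemma inner_content_le: "open U \<Longrightarrow> inner_content U \<le> l U"
  unfolding inner_content_def by (rule SUP_least) (auto intro: content_le)

lemma inner_content_empty: "inner_content {} = 0"
  using inner_content_le[of "{}"] by (simp add: empty)

lemma inner_content_Un_le:
  assumes "open U" "open V"
  shows "inner_content (U \<union> V) \<le> inner_content U + inner_content V"
  unfolding inner_content_def[of "U \<union> V"]
proof (rule SUP_least)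
  fix K assume "K \<in> {K. compact K \<and> closed K \<and> K \<subseteq> U \<union> V}"
  then have "compact K" "closed K" "K \<subseteq> U \<union> V" by auto
  from regular_compact_split[OF regular this(1,2) assms this(3)]
  obtain K1 K2 where "compact K1" "closed K1" "K1 \<subseteq> U" "compact K2" "closed K2" "K2 \<subseteq> V" "K = K1 \<union> K2"
    by metis
  then show "content K \<le> inner_content U + inner_content V"
    using content_Un_le[of K1 K2] content_le_inner_content[of K1 U] content_le_inner_content[of K2 V]
    by (meson add_mono order_trans)
qed

text \<open>As \<open>l\<close> is only finitely additive, countable subadditivity has to come from
  compactness: finitely many \<open>U i\<close> cover a compact subset of the union.\<close>

lemma inner_content_UN_le:
  fixes U :: "nat \<Rightarrow> 'a set"
  assumes U: "\<And>i. open (U i)"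
  shows "inner_content (\<Union>i. U i) \<le> (\<Sum>i. inner_content (U i))"
  unfolding inner_content_def[of "\<Union>i. U i"]
proof (rule SUP_least)
  fix K assume "K \<in> {K. compact K \<and> closed K \<and> K \<subseteq> (\<Union>i. U i)}"
  then have K: "compact K" "closed K" "K \<subseteq> (\<Union>i. U i)" by auto
  obtain F where F: "finite F" "K \<subseteq> (\<Union>i\<in>F. U i)"
    using compactE_image[OF K(1), of UNIV U] K(3) U by auto
  have "inner_content (\<Union>i\<in>F. U i) \<le> (\<Sum>i\<in>F. inner_content (U i))"
    using F(1)
  proof (induction F)
    case (insert i F)
    have "inner_content (\<Union>i\<in>insert i F. U i) \<le> inner_content (U i) + inner_content (\<Union>i\<in>F. U i)"
      using inner_content_Un_le[of "U i" "\<Union>i\<in>F. U i"] U by auto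
    also have "\<dots> \<le> inner_content (U i) + (\<Sum>i\<in>F. inner_content (U i))"
      by (intro add_left_mono insert.IH)
    finally show ?case using insert by simp
  qed (simp add: inner_content_empty)
  moreover have "(\<Sum>i\<in>F. inner_content (U i)) \<le> (\<Sum>i. inner_content (U i))"
    by (rule sum_le_suminf) (use F in auto)
  ultimately show "content K \<le> (\<Sum>i. inner_content (U i))"
    using content_le_inner_content[OF K(1,2) F(2)] by order
qed

section \<open>The outer measure and its measurable sets\<close>

lemma outer_mono: "A \<subseteq> B \<Longrightarrow> outer A \<le> outer B"
  unfolding outer_def by (rule INF_superset_mono) auto

lemma outer_open: "open U \<Longrightarrow> outer U = inner_content U"
  unfolding outer_def
  by (intro antisym INF_greatest INF_lower2[of U]) (auto intro: inner_content_mono)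

lemma outer_le: "open U \<Longrightarrow> E \<subseteq> U \<Longrightarrow> outer E \<le> inner_content U"
  unfolding outer_def by (rule INF_lower) auto

lemma outer_finite: "outer E < top"
  using outer_le[of UNIV E] inner_content_le[of UNIV] by (simp add: le_less_trans)

lemma outer_approx:
  assumes "e > 0"
  obtains U where "open U" "E \<subseteq> U" "inner_content U \<le> outer E + ennreal e"
proof -
  have "outer E < outer E + ennreal e"
    using outer_finite[of E] assms by (cases "outer E") (auto simp: ennreal_plus[symmetric] ennreal_less_iff simp del: ennreal_plus)
  then obtain U where "open U" "E \<subseteq> U" "inner_content U < outer E + ennreal e"
    unfolding outer_def[of E] INF_less_iff by auto
  then show thesis by (intro that) auto
qed

lemma outer_UN_le:
  fixes E :: "nat \<Rightarrow> 'a set"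
  shows "outer (\<Union>i. E i) \<le> (\<Sum>i. outer (E i))"
proof (rule ennreal_le_epsilon)
  fix e :: real assume e: "0 < e"
  have "\<exists>U. open U \<and> E i \<subseteq> U \<and> inner_content U \<le> outer (E i) + ennreal (e * (1/2) ^ Suc i)" for i
    using outer_approx[of "e * (1/2) ^ Suc i" "E i"] e by (metis mult_pos_pos zero_less_power half_gt_zero_iff zero_less_one)
  then obtain U where U: "\<And>i. open (U i)" "\<And>i. E i \<subseteq> U i"
    "\<And>i. inner_content (U i) \<le> outer (E i) + ennreal (e * (1/2) ^ Suc i)"
    by metis
  have "outer (\<Union>i. E i) \<le> inner_content (\<Union>i. U i)"
    using U by (intro outer_le) auto
  also have "\<dots> \<le> (\<Sum>i. inner_content (U i))"
    by (rule inner_content_UN_le) (rule U)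
  also have "\<dots> \<le> (\<Sum>i. outer (E i) + ennreal (e * (1/2) ^ Suc i))"
    by (intro suminf_le summableI U)
  also have "\<dots> = (\<Sum>i. outer (E i)) + (\<Sum>i. ennreal (e * (1/2) ^ Suc i))"
    by (simp add: suminf_add)
  also have "(\<Sum>i. ennreal (e * (1/2) ^ Suc i)) = ennreal e"
    using e sums_mult[OF power_half_series, of e] by (intro suminf_ennreal_eq) auto
  finally show "outer (\<Union>i. E i) \<le> (\<Sum>i. outer (E i)) + ennreal e" .
qed

text \<open>Caratheodory's condition for open \<open>U\<close>, tested on open \<open>V\<close>.
  Choosing a compact \<open>K\<close> in \<open>V \<inter> U\<close> first makes
  \<open>V - K\<close> an open set around \<open>V - U\<close>, so that it can be exhausted in turn
  by compact sets \<open>L\<close> disjoint from \<open>K\<close>.\<close>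

lemma inner_content_add_outer_le:
  assumes U: "open U" and V: "open V"
  shows "inner_content (V \<inter> U) + outer (V - U) \<le> inner_content V"
proof -
  have "(SUP K\<in>{K. compact K \<and> closed K \<and> K \<subseteq> V \<inter> U}. content K + outer (V - U)) \<le> inner_content V"
  proof (rule SUP_least)
    fix K assume "K \<in> {K. compact K \<and> closed K \<and> K \<subseteq> V \<inter> U}"
    then have K: "compact K" "closed K" "K \<subseteq> V \<inter> U" by auto
    have "(SUP L\<in>{L. compact L \<and> closed L \<and> L \<subseteq> V - K}. content K + content L) \<le> inner_content V"
    proof (rule SUP_least)
      fix L assume "L \<in> {L. compact L \<and> closed L \<and> L \<subseteq> V - K}"
      then have L: "compact L" "closed L" "L \<subseteq> V - K" by auto
      have "content K + content L \<le> content (K \<union> L)"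
        using K L by (intro content_disjoint_le) auto
      also have "\<dots> \<le> inner_content V"
        using K L by (intro content_le_inner_content) (auto intro: compact_Un)
      finally show "content K + content L \<le> inner_content V" .
    qed
    moreover have "(SUP L\<in>{L. compact L \<and> closed L \<and> L \<subseteq> V - K}. content K + content L)
        = content K + inner_content (V - K)"
      unfolding inner_content_def by (rule ennreal_SUP_add_right[symmetric]) auto
    moreover have "outer (V - U) \<le> inner_content (V - K)"
      using K V by (intro outer_le) auto
    ultimately show "content K + outer (V - U) \<le> inner_content V"
      by (metis add_left_mono order_trans)
  qed
  moreover have "(SUP K\<in>{K. compact K \<and> closed K \<and> K \<subseteq> V \<inter> U}. content K + outer (V - U))
      = inner_content (V \<inter> U) + outer (V - U)"
    unfolding inner_content_def by (rule ennreal_SUP_add_left) auto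
  ultimately show ?thesis by simp
qed

lemma outer_measure_space_outer: "outer_measure_space (Pow UNIV) outer"
  unfolding outer_measure_space_def
  by (auto simp: positive_def increasing_def countably_subadditive_def outer_open inner_content_empty
      outer_UN_le outer_mono)

lemma outer_add: "outer (A \<union> B) \<le> outer A + outer B"
proof -
  interpret P: sigma_algebra UNIV "Pow UNIV :: 'a set set" by (rule sigma_algebra_Pow)
  have "subadditive (Pow UNIV) outer"
    using outer_measure_space_outer
    by (intro P.countably_subadditive_subadditive) (auto simp: outer_measure_space_def)
  then have "outer (A \<union> (B - A)) \<le> outer A + outer (B - A)"
    by (auto simp: subadditive_def simp del: Un_Diff_cancel)
  also have "\<dots> \<le> outer A + outer B"
    by (intro add_left_mono outer_mono) auto
  finally show ?thesis by simp
qed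

text \<open>Open test sets suffice for one inequality because \<open>outer E\<close> is an infimum
  over open \<open>V \<supseteq> E\<close>; the other inequality is subadditivity.\<close>

lemma open_lambda_system:
  assumes U: "open U"
  shows "U \<in> lambda_system UNIV (Pow UNIV) outer"
proof -
  have "outer (U \<inter> E) + outer ((UNIV - U) \<inter> E) = outer E" for E
  proof (rule antisym)
    show "outer (U \<inter> E) + outer ((UNIV - U) \<inter> E) \<le> outer E"
      unfolding outer_def[of E]
    proof (rule INF_greatest)
      fix V assume "V \<in> {V. open V \<and> E \<subseteq> V}"
      then have V: "open V" "E \<subseteq> V" by auto
      have "outer (U \<inter> E) + outer ((UNIV - U) \<inter> E) \<le> inner_content (V \<inter> U) + outer (V - U)"
        using U V by (intro add_mono outer_le outer_mono) auto
      also have "\<dots> \<le> inner_content V"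
        by (rule inner_content_add_outer_le[OF U V(1)])
      finally show "outer (U \<inter> E) + outer ((UNIV - U) \<inter> E) \<le> inner_content V" .
    qed
    have "outer E = outer (U \<inter> E \<union> (UNIV - U) \<inter> E)" by (rule arg_cong[of _ _ outer]) auto
    then show "outer E \<le> outer (U \<inter> E) + outer ((UNIV - U) \<inter> E)"
      using outer_add by simp
  qed
  then show ?thesis by (simp add: lambda_system_def)
qed

lemma measure_space_outer: "measure_space UNIV (sets borel) outer"
proof -
  interpret P: sigma_algebra UNIV "Pow UNIV :: 'a set set" by (rule sigma_algebra_Pow)
  have *: "measure_space UNIV (lambda_system UNIV (Pow UNIV) outer) outer"
    by (rule P.caratheodory_lemma[OF outer_measure_space_outer])
  then interpret L: sigma_algebra UNIV "lambda_system UNIV (Pow UNIV) outer"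
    by (simp add: measure_space_def)
  have "sigma_sets UNIV {S::'a set. open S} \<subseteq> lambda_system UNIV (Pow UNIV) outer"
    using open_lambda_system by (intro L.sigma_sets_subset) auto
  then have "sets borel \<subseteq> lambda_system UNIV (Pow UNIV) outer"
    by (simp add: borel_def)
  moreover have "sigma_algebra UNIV (sets (borel :: 'a measure))"
    using sets.sigma_algebra_axioms[of "borel :: 'a measure"] by simp
  ultimately show ?thesis
    using * measure_down by blast
qed

section \<open>The Radon measure obtained from the charge\<close>

definition radon_measure :: "'a measure" where
  "radon_measure = measure_of UNIV (sets borel) outer"

lemma sets_radon_measure: "sets radon_measure = sets borel"
  unfolding radon_measure_def by (metis sets.sets_measure_of_eq space_borel)

lemma emeasure_radon_measure: "B \<in> sets borel \<Longrightarrow> emeasure radon_measure B = outer B"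
  unfolding radon_measure_def using measure_space_outer
  by (intro emeasure_measure_of_sigma) (auto simp: measure_space_def)

lemma finite_measure_radon_measure: "finite_measure radon_measure"
  using outer_finite sets_radon_measure
  by (intro finite_measureI) (simp add: emeasure_radon_measure sets_eq_imp_space_eq less_top[symmetric])

lemma measure_radon_measure_open_le: "open U \<Longrightarrow> measure radon_measure U \<le> l U"
  using inner_content_le[of U] nonneg[of U]
  by (simp add: measure_def emeasure_radon_measure outer_open enn2real_leI)

text \<open>Domination on open sets gives one inequality. For the other, tightness supplies a
  compact \<open>K\<close> carrying all but \<open>e\<close> of the charge, and the content of its
  closure is at least \<open>l K\<close>.\<close>

lemma radon_measure_UNIV: "measure radon_measure UNIV = l UNIV"
proof (rule antisym)
  show "measure radon_measure UNIV \<le> l UNIV" by (rule measure_radon_measure_open_le) simp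
  show "l UNIV \<le> measure radon_measure UNIV"
  proof (rule field_le_epsilon)
    fix e :: real assume "0 < e"
    with tight obtain K where K: "compact K" "l (- K) \<le> e" by blast
    have "ennreal (l K) \<le> content (closure K)"
      using le_content[of K] content_mono[OF closure_subset, of K] by order
    also have "\<dots> \<le> emeasure radon_measure UNIV"
      using regular_compact_closure[OF regular K(1)]
      by (simp add: emeasure_radon_measure outer_open content_le_inner_content)
    finally have "l K \<le> measure radon_measure UNIV"
      using finite_measure.emeasure_finite[OF finite_measure_radon_measure, of UNIV] nonneg[of K]
      by (simp add: finite_measure.emeasure_eq_measure[OF finite_measure_radon_measure])
    moreover have "l UNIV = l K + l (- K)" using add[of K "- K"] by (simp add: Compl_partition)
    ultimately show "l UNIV \<le> measure radon_measure UNIV + e" using K(2) by simp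
  qed
qed

text \<open>Inner regularity at \<open>B\<close> comes from outer regularity at \<open>- B\<close>:
  if an open \<open>U\<close> exceeds \<open>- B\<close> by little and \<open>?K\<close> carries
  almost all the mass, then \<open>?K - U\<close> is a closed compact subset of \<open>B\<close>
  that misses little of it.\<close>

lemma radon_measure_in_radon_measures: "radon_measure \<in> radon_measures"
proof (rule radon_measuresI[OF regular sets_radon_measure finite_measure_radon_measure])
  interpret finite_measure radon_measure by (rule finite_measure_radon_measure)
  note [simp] = sets_radon_measure
  fix B :: "'a set" and e :: real assume B: "B \<in> sets borel" and e: "0 < e"
  \<comment> \<open>There are two errors of at most \<open>e/3\<close> each; the remaining third
    makes the final inequality strict.\<close>
  obtain K where K: "compact K" "l (- K) \<le> e/3" using tight[of "e/3"] e by auto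
  let ?K = "closure K"
  have "l (- ?K) \<le> l (- K)" using closure_subset[of K] by (intro mono) auto
  then have 1: "measure radon_measure (- ?K) \<le> e/3"
    using measure_radon_measure_open_le[of "- ?K"] K(2) open_Compl[OF closed_closure, of K] by linarith
  obtain U where U: "open U" "- B \<subseteq> U" "inner_content U \<le> outer (- B) + ennreal (e/3)"
    by (rule outer_approx[of "e/3" "- B"]) (use e in auto)
  have "emeasure radon_measure U \<le> emeasure radon_measure (- B) + ennreal (e/3)"
    using U B by (simp add: emeasure_radon_measure outer_open borel_comp)
  then have "measure radon_measure U \<le> measure radon_measure (- B) + e/3"
    using e by (simp add: emeasure_eq_measure ennreal_plus[symmetric] del: ennreal_plus)
  moreover have "measure radon_measure (U - - B) = measure radon_measure U - measure radon_measure (- B)"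
    using U B by (intro finite_measure_Diff) (auto simp: borel_comp)
  moreover have "U - - B = B \<inter> U" by auto
  ultimately have 2: "measure radon_measure (B \<inter> U) \<le> e/3"
    by simp
  have "measure radon_measure (B - (?K - U)) \<le> measure radon_measure (B \<inter> U \<union> - ?K)"
    using U B by (intro finite_measure_mono) auto
  also have "\<dots> \<le> measure radon_measure (B \<inter> U) + measure radon_measure (- ?K)"
    using U B by (intro measure_Un_le) auto
  finally have "measure radon_measure (B - (?K - U)) < e" using 1 2 e by simp
  moreover have "closed (?K - U)" using U by (intro closed_Diff) auto
  moreover have "compact (?K - U)" using U K regular_compact_closure[OF regular] by (intro compact_diff) auto
  ultimately show "\<exists>C. compact C \<and> C \<subseteq> B \<and> measure radon_measure (B - closure C) < e"
    using U by (intro exI[of _ "?K - U"]) auto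
qed

end

section \<open>Gluing\<close>

text \<open>\<open>q\<close> sends each point to a chosen representative of its atom in the finite
  algebra generated by \<open>\<A>\<close>. The partition is thus encoded by the fibres of
  \<open>q\<close>, and a set that equals its own preimage is a union of fibres that can be
  recognised at the representatives.\<close>

lemma finite_partition_map:
  fixes \<A> :: "'a::topological_space set set"
  assumes \<A>: "finite \<A>" "\<A> \<subseteq> sets borel"
  obtains q :: "'a \<Rightarrow> 'a" where "finite (range q)" "\<And>z. q -` {z} \<in> sets borel" "\<And>A. A \<in> \<A> \<Longrightarrow> q -` A = A"
proof -
  define \<sigma> where "\<sigma> x = {A \<in> \<A>. x \<in> A}" for x
  define g where "g \<T> = (SOME y. \<sigma> y = \<T>)" for \<T>
  define q where "q x = g (\<sigma> x)" for x
  have \<sigma>q: "\<sigma> (q x) = \<sigma> x" for x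
    unfolding q_def g_def by (rule someI[of _ x]) simp
  show thesis
  proof (rule that[of q])
    have "range q \<subseteq> g ` Pow \<A>" by (auto simp: q_def \<sigma>_def)
    then show "finite (range q)" using \<A>(1) by (simp add: finite_subset)
  next
    fix A assume "A \<in> \<A>"
    then have "x \<in> A \<longleftrightarrow> A \<in> \<sigma> x" for x by (simp add: \<sigma>_def)
    then show "q -` A = A" using \<sigma>q by auto
  next
    fix z
    show "q -` {z} \<in> sets borel"
    proof (cases "z \<in> range q")
      case True
      then obtain w where w: "z = q w" by blast
      have eq: "q x = z \<longleftrightarrow> \<sigma> x = \<sigma> w" for x
        unfolding w using \<sigma>q by (metis q_def)
      have "q -` {z} = (\<Inter>A\<in>\<A>. if w \<in> A then A else - A)"
      proof (rule set_eqI)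
        fix x
        have "x \<in> q -` {z} \<longleftrightarrow> (\<forall>A\<in>\<A>. x \<in> A \<longleftrightarrow> w \<in> A)"
          by (auto simp: eq \<sigma>_def)
        also have "\<dots> \<longleftrightarrow> x \<in> (\<Inter>A\<in>\<A>. if w \<in> A then A else - A)"
          by (auto split: if_splits)
        finally show "x \<in> q -` {z} \<longleftrightarrow> x \<in> (\<Inter>A\<in>\<A>. if w \<in> A then A else - A)" .
      qed
      moreover have "(\<Inter>A\<in>\<A>. if w \<in> A then A else - A) \<in> sets borel"
      proof (cases "\<A> = {}")
        case False
        then show ?thesis using \<A> by (intro sets.finite_INT) (auto simp: borel_comp)
      qed simp
      ultimately show ?thesis by simp
    next
      case False
      then have "q -` {z} = {}" by auto
      then show ?thesis by simp
    qed
  qed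
qed

text \<open>The indicators are evaluated at representatives only. Since \<open>A\<close> and
  \<open>C\<close> are unions of fibres, they select exactly the cells that make up
  \<open>A \<times> C\<close>.\<close>

lemma measure_Times_partition:
  fixes \<mu> :: "('a::topological_space \<times> 'b::topological_space) measure"
  assumes \<mu>: "sets \<mu> = sets borel" "finite_measure \<mu>"
    and q: "finite (range q)" "\<And>z. q -` {z} \<in> sets borel" "q -` A = A"
    and r: "finite (range r)" "\<And>z. r -` {z} \<in> sets borel" "r -` C = C"
  shows "(\<Sum>x\<in>range q. \<Sum>s\<in>range r. indicator A x * indicator C s * measure \<mu> (q -` {x} \<times> r -` {s}))
    = measure \<mu> (A \<times> C)"
proof -
  interpret finite_measure \<mu> by fact
  define E where "E = (\<lambda>(x, s). if x \<in> A \<and> s \<in> C then q -` {x} \<times> r -` {s} else {})"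
  have UN: "(\<Union>z\<in>range q \<times> range r. E z) = A \<times> C"
    using q(3) r(3) by (fastforce simp: E_def split: if_splits)
  have "(\<Sum>x\<in>range q. \<Sum>s\<in>range r. indicator A x * indicator C s * measure \<mu> (q -` {x} \<times> r -` {s}))
      = (\<Sum>x\<in>range q. \<Sum>s\<in>range r. measure \<mu> (E (x, s)))"
    by (intro sum.cong refl) (auto simp: E_def)
  also have "\<dots> = (\<Sum>z\<in>range q \<times> range r. measure \<mu> (E z))"
    by (simp add: sum.cartesian_product case_prod_unfold)
  also have "\<dots> = measure \<mu> (\<Union>z\<in>range q \<times> range r. E z)"
  proof (rule measure_finite_Union[symmetric])
    show "E ` (range q \<times> range r) \<subseteq> sets \<mu>"
      using q(2) r(2) by (auto simp: E_def \<mu>(1) intro!: borel_Times)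
    show "disjoint_family_on E (range q \<times> range r)"
      by (auto simp: disjoint_family_on_def E_def split: if_splits)
  qed (use q r in auto)
  finally show ?thesis by (simp add: UN)
qed

text \<open>Summing out \<open>y\<close> turns \<open>n y s\<close> into \<open>v s\<close>, which
  cancels the denominator; where \<open>v s = 0\<close>, both sides vanish together with
  \<open>p\<close>. The weight \<open>a\<close> will be the indicator of a rectangle.\<close>

lemma sum_conditional_product:
  fixes a p :: "'x \<Rightarrow> 's \<Rightarrow> real"
  assumes "\<And>s. s \<in> H \<Longrightarrow> (\<Sum>y\<in>G. n y s) = v s" "\<And>x s. v s = 0 \<Longrightarrow> p x s = 0"
  shows "(\<Sum>x\<in>F. \<Sum>y\<in>G. \<Sum>s\<in>H. a x s * (p x s * n y s / v s)) = (\<Sum>x\<in>F. \<Sum>s\<in>H. a x s * p x s)"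
proof (rule sum.cong[OF refl])
  fix x
  have "(\<Sum>y\<in>G. \<Sum>s\<in>H. a x s * (p x s * n y s / v s)) = (\<Sum>s\<in>H. \<Sum>y\<in>G. a x s * p x s / v s * n y s)"
    by (subst sum.swap) (simp add: mult.assoc)
  also have "\<dots> = (\<Sum>s\<in>H. a x s * p x s / v s * v s)"
    using assms(1) by (intro sum.cong refl) (simp only: sum_distrib_left[symmetric])
  also have "\<dots> = (\<Sum>s\<in>H. a x s * p x s)"
    using assms(2) by (intro sum.cong refl) auto
  finally show "(\<Sum>y\<in>G. \<Sum>s\<in>H. a x s * (p x s * n y s / v s)) = (\<Sum>s\<in>H. a x s * p x s)" .
qed

text \<open>The charge is a finite sum of point masses at representatives of the cells. It is
  therefore defined on arbitrary subsets, and it is exact on the rectangles from \<open>T\<close>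
  because their sides are unions of fibres.\<close>

lemma finite_gluing:
  fixes \<mu> :: "('x::topological_space \<times> 's::topological_space) measure"
    and \<nu> :: "('y::topological_space \<times> 's) measure"
  assumes \<mu>: "sets \<mu> = sets borel" "finite_measure \<mu>"
    and \<nu>: "sets \<nu> = sets borel" "finite_measure \<nu>"
    and snd_eq: "\<And>C. C \<in> sets borel \<Longrightarrow> measure \<mu> (UNIV \<times> C) = measure \<nu> (UNIV \<times> C)"
    and T: "finite T" "T \<subseteq> sets borel \<times> sets borel \<times> sets borel"
  obtains l :: "('x \<times> 'y \<times> 's) set \<Rightarrow> real"
  where "\<And>E. 0 \<le> l E" "\<And>E F. E \<inter> F = {} \<Longrightarrow> l (E \<union> F) = l E + l F"
    "\<And>A B C. (A, B, C) \<in> T \<Longrightarrow> l (A \<times> UNIV \<times> C) = measure \<mu> (A \<times> C)"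
    "\<And>A B C. (A, B, C) \<in> T \<Longrightarrow> l (UNIV \<times> B \<times> C) = measure \<nu> (B \<times> C)"
proof -
  have "finite (fst ` T)" "fst ` T \<subseteq> sets borel" using T by auto
  then obtain q :: "'x \<Rightarrow> 'x" where q: "finite (range q)" "\<And>z. q -` {z} \<in> sets borel"
      "\<And>A. A \<in> fst ` T \<Longrightarrow> q -` A = A"
    using finite_partition_map by blast
  have "finite ((fst \<circ> snd) ` T)" "(fst \<circ> snd) ` T \<subseteq> sets borel" using T by auto
  then obtain t :: "'y \<Rightarrow> 'y" where t: "finite (range t)" "\<And>z. t -` {z} \<in> sets borel"
      "\<And>B. B \<in> (fst \<circ> snd) ` T \<Longrightarrow> t -` B = B"
    using finite_partition_map by blast
  have "finite ((snd \<circ> snd) ` T)" "(snd \<circ> snd) ` T \<subseteq> sets borel" using T by auto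
  then obtain r :: "'s \<Rightarrow> 's" where r: "finite (range r)" "\<And>z. r -` {z} \<in> sets borel"
      "\<And>C. C \<in> (snd \<circ> snd) ` T \<Longrightarrow> r -` C = C"
    using finite_partition_map by blast
  define p where "p x s = measure \<mu> (q -` {x} \<times> r -` {s})" for x s
  define n where "n y s = measure \<nu> (t -` {y} \<times> r -` {s})" for y s
  define v where "v s = measure \<mu> (UNIV \<times> r -` {s})" for s
  \<comment> \<open>Where \<open>v s = 0\<close>, the quotient is \<open>0\<close> by convention, which is harmless by \<open>p0\<close> and \<open>n0\<close> below.\<close>
  define l where "l E = (\<Sum>x\<in>range q. \<Sum>y\<in>range t. \<Sum>s\<in>range r. indicator E (x, y, s) * (p x s * n y s / v s))"
    for E :: "('x \<times> 'y \<times> 's) set"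
  have v': "v s = measure \<nu> (UNIV \<times> r -` {s})" for s
    unfolding v_def by (rule snd_eq[OF r(2)])
  have UNIV_r: "UNIV \<times> r -` {s} \<in> sets borel" for s
    using r(2) by (auto intro!: borel_Times)
  have p0: "p x s = 0" if "v s = 0" for x s
  proof -
    have "p x s \<le> v s" unfolding p_def v_def
      by (intro finite_measure.finite_measure_mono[OF \<mu>(2)]) (use UNIV_r \<mu>(1) in auto)
    then show ?thesis using that by (simp add: p_def measure_le_0_iff)
  qed
  have n0: "n y s = 0" if "v s = 0" for y s
  proof -
    have "n y s \<le> v s" unfolding n_def v'
      by (intro finite_measure.finite_measure_mono[OF \<nu>(2)]) (use UNIV_r \<nu>(1) in auto)
    then show ?thesis using that by (simp add: n_def measure_le_0_iff)
  qed
  have sum_p: "(\<Sum>x\<in>range q. p x s) = v s" for s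
  proof -
    have "measure \<mu> (UNIV \<times> r -` {s}) = measure \<mu> (\<Union>x\<in>range q. q -` {x} \<times> r -` {s})"
      by (rule arg_cong[of _ _ "measure \<mu>"]) auto
    also have "\<dots> = (\<Sum>x\<in>range q. p x s)" unfolding p_def
    proof (rule measure_finite_Union)
      show "(\<lambda>x. q -` {x} \<times> r -` {s}) ` range q \<subseteq> sets \<mu>"
        using q(2) r(2) by (auto simp: \<mu>(1) intro!: borel_Times)
    qed (use q finite_measure.emeasure_finite[OF \<mu>(2)] in \<open>auto simp: disjoint_family_on_def\<close>)
    finally show ?thesis by (simp add: v_def)
  qed
  have sum_n: "(\<Sum>y\<in>range t. n y s) = v s" for s
  proof -
    have "measure \<nu> (UNIV \<times> r -` {s}) = measure \<nu> (\<Union>x\<in>range t. t -` {x} \<times> r -` {s})"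
      by (rule arg_cong[of _ _ "measure \<nu>"]) auto
    also have "\<dots> = (\<Sum>y\<in>range t. n y s)" unfolding n_def
    proof (rule measure_finite_Union)
      show "(\<lambda>x. t -` {x} \<times> r -` {s}) ` range t \<subseteq> sets \<nu>"
        using t(2) r(2) by (auto simp: \<nu>(1) intro!: borel_Times)
    qed (use t finite_measure.emeasure_finite[OF \<nu>(2)] in \<open>auto simp: disjoint_family_on_def\<close>)
    finally show ?thesis by (simp add: v')
  qed
  show thesis
  proof (rule that[of l])
    show "0 \<le> l E" for E
      unfolding l_def by (intro sum_nonneg) (auto simp: p_def n_def v_def)
    show "l (E \<union> F) = l E + l F" if "E \<inter> F = {}" for E F
      unfolding l_def sum.distrib[symmetric] using that
      by (intro sum.cong refl) (auto simp: indicator_def)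
    fix A B C assume ABC: "(A, B, C) \<in> T"
    have inv: "q -` A = A" "t -` B = B" "r -` C = C"
      by (rule q(3) t(3) r(3), rule image_eqI[OF _ ABC], simp)+
    have "l (A \<times> UNIV \<times> C) = (\<Sum>x\<in>range q. \<Sum>y\<in>range t. \<Sum>s\<in>range r.
        (indicator A x * indicator C s) * (p x s * n y s / v s))"
      unfolding l_def by (intro sum.cong refl) (auto simp: indicator_def)
    also have "\<dots> = (\<Sum>x\<in>range q. \<Sum>s\<in>range r. (indicator A x * indicator C s) * p x s)"
      by (rule sum_conditional_product) (auto simp: sum_n p0)
    also have "\<dots> = measure \<mu> (A \<times> C)"
      unfolding p_def by (rule measure_Times_partition[OF \<mu> q(1,2) inv(1) r(1,2) inv(3)])
    finally show "l (A \<times> UNIV \<times> C) = measure \<mu> (A \<times> C)" .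
    \<comment> \<open>The weights are symmetric in \<open>p\<close> and \<open>n\<close>, so once
      \<open>y\<close> is the outermost summation variable the same cancellation applies with the
      roles exchanged.\<close>
    have "l (UNIV \<times> B \<times> C) = (\<Sum>y\<in>range t. \<Sum>x\<in>range q. \<Sum>s\<in>range r.
        (indicator B y * indicator C s) * (n y s * p x s / v s))"
      unfolding l_def by (subst sum.swap, intro sum.cong refl) (auto simp: indicator_def)
    also have "\<dots> = (\<Sum>y\<in>range t. \<Sum>s\<in>range r. (indicator B y * indicator C s) * n y s)"
      by (rule sum_conditional_product) (auto simp: sum_p n0)
    also have "\<dots> = measure \<nu> (B \<times> C)"
      unfolding n_def by (rule measure_Times_partition[OF \<nu> t(1,2) inv(2) r(1,2) inv(3)])
    finally show "l (UNIV \<times> B \<times> C) = measure \<nu> (B \<times> C)" .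
  qed
qed

section \<open>From finite partitions to all Borel rectangles by compactness\<close>

lemma compact_PiE_UNIV:
  fixes S :: "'i \<Rightarrow> 'a::topological_space set"
  assumes "\<And>i. compact (S i)"
  shows "compact (PiE UNIV S)"
  using compactin_PiE[of "\<lambda>_. euclidean" UNIV S] assms
  by (simp add: euclidean_product_topology)

text \<open>Each equation involves three coordinates only, and coordinates are continuous for
  pointwise convergence.\<close>

lemma closed_additive:
  "closed {l :: 'a set \<Rightarrow> real. \<forall>E F. E \<inter> F = {} \<longrightarrow> l (E \<union> F) = l E + l F}"
  by (intro closed_Collect_all closed_Collect_imp closed_Collect_eq open_Collect_const
      continuous_on_add continuous_on_product_coordinates)

lemma charge_gluing:
  fixes \<mu> :: "('x::topological_space \<times> 's::topological_space) measure"
    and \<nu> :: "('y::topological_space \<times> 's) measure"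
  assumes \<mu>: "sets \<mu> = sets borel" "finite_measure \<mu>"
    and \<nu>: "sets \<nu> = sets borel" "finite_measure \<nu>"
    and snd_eq: "\<And>C. C \<in> sets borel \<Longrightarrow> measure \<mu> (UNIV \<times> C) = measure \<nu> (UNIV \<times> C)"
  obtains l :: "('x \<times> 'y \<times> 's) set \<Rightarrow> real"
  where "\<And>E. 0 \<le> l E" "\<And>E F. E \<inter> F = {} \<Longrightarrow> l (E \<union> F) = l E + l F"
    "\<And>A C. A \<in> sets borel \<Longrightarrow> C \<in> sets borel \<Longrightarrow> l (A \<times> UNIV \<times> C) = measure \<mu> (A \<times> C)"
    "\<And>B C. B \<in> sets borel \<Longrightarrow> C \<in> sets borel \<Longrightarrow> l (UNIV \<times> B \<times> C) = measure \<nu> (B \<times> C)"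
proof -
  define K where "K = PiE UNIV (\<lambda>E :: ('x \<times> 'y \<times> 's) set. {0..measure \<mu> UNIV})"
  define I :: "('x set \<times> 'y set \<times> 's set) set" where "I = sets borel \<times> sets borel \<times> sets borel"
  \<comment> \<open>Additivity is part of every \<open>G i\<close>, so that it survives in the
    intersection.\<close>
  define G where "G = (\<lambda>(A, B, C). {l :: ('x \<times> 'y \<times> 's) set \<Rightarrow> real.
      (\<forall>E F. E \<inter> F = {} \<longrightarrow> l (E \<union> F) = l E + l F) \<and>
      l (A \<times> UNIV \<times> C) = measure \<mu> (A \<times> C) \<and> l (UNIV \<times> B \<times> C) = measure \<nu> (B \<times> C)})"
  have "K \<inter> (\<Inter>i\<in>I. G i) \<noteq> {}"
  proof (rule compact_imp_fip_image)
    show "compact K" unfolding K_def by (rule compact_PiE_UNIV) simp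
    show "closed (G i)" for i
      unfolding G_def case_prod_unfold
      by (intro closed_Collect_conj closed_additive closed_Collect_eq continuous_on_const
          continuous_on_product_coordinates)
    fix I' assume I': "finite I'" "I' \<subseteq> I"
    \<comment> \<open>The added triple fixes \<open>l UNIV = measure \<mu> UNIV\<close>, which
      bounds all values of \<open>l\<close> and places it in the box \<open>K\<close>.\<close>
    have "finite (insert (UNIV, UNIV, UNIV) I')"
      "insert (UNIV, UNIV, UNIV) I' \<subseteq> sets borel \<times> sets borel \<times> sets borel"
      using I' by (auto simp: I_def)
    from finite_gluing[OF \<mu> \<nu> snd_eq this] obtain l :: "('x \<times> 'y \<times> 's) set \<Rightarrow> real" where l:
      "\<And>E. 0 \<le> l E" "\<And>E F. E \<inter> F = {} \<Longrightarrow> l (E \<union> F) = l E + l F"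
      "\<And>A B C. (A, B, C) \<in> insert (UNIV, UNIV, UNIV) I' \<Longrightarrow> l (A \<times> UNIV \<times> C) = measure \<mu> (A \<times> C)"
      "\<And>A B C. (A, B, C) \<in> insert (UNIV, UNIV, UNIV) I' \<Longrightarrow> l (UNIV \<times> B \<times> C) = measure \<nu> (B \<times> C)"
      by metis
    have "l E \<le> measure \<mu> UNIV" for E
      using l(1)[of "- E"] l(2)[of E "- E"] l(3)[of UNIV UNIV UNIV] by (simp add: Compl_partition)
    then have "l \<in> K" using l(1) by (auto simp: K_def)
    moreover have "l \<in> G i" if "i \<in> I'" for i
    proof -
      obtain A B C where "i = (A, B, C)" by (cases i)
      with that l(2) l(3,4)[of A B C] show ?thesis by (simp add: G_def)
    qed
    ultimately show "K \<inter> (\<Inter>i\<in>I'. G i) \<noteq> {}" by blast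
  qed
  then obtain l where lK: "l \<in> K" and l: "\<And>A B C. A \<in> sets borel \<Longrightarrow> B \<in> sets borel \<Longrightarrow> C \<in> sets borel \<Longrightarrow> l \<in> G (A, B, C)"
    by (auto simp: I_def)
  show thesis
  proof (rule that[of l])
    show "0 \<le> l E" for E using lK by (auto simp: K_def PiE_iff)
    show "l (E \<union> F) = l E + l F" if "E \<inter> F = {}" for E F
      using l[of UNIV UNIV UNIV] that by (simp add: G_def)
    show "l (A \<times> UNIV \<times> C) = measure \<mu> (A \<times> C)" if "A \<in> sets borel" "C \<in> sets borel" for A C
      using l[of A UNIV C] that by (simp add: G_def)
    show "l (UNIV \<times> B \<times> C) = measure \<nu> (B \<times> C)" if "B \<in> sets borel" "C \<in> sets borel" for B C
      using l[of UNIV B C] that by (simp add: G_def)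
  qed
qed

section \<open>Identification of Radon measures by finite unions of rectangles\<close>

lemma additive_eq_measure_finite_Union:
  fixes f :: "'a set \<Rightarrow> real"
  assumes add: "\<And>A B. A \<inter> B = {} \<Longrightarrow> f (A \<union> B) = f A + f B"
    and \<mu>: "finite_measure \<mu>"
    and R: "\<R> \<subseteq> sets \<mu>" "Int_stable \<R>" "\<And>A. A \<in> \<R> \<Longrightarrow> f A = measure \<mu> A"
    and F: "finite F" "F \<subseteq> \<R>"
  shows "f (\<Union>F) = measure \<mu> (\<Union>F)"
  using F
\<comment> \<open>Inclusion-exclusion one set at a time. The overlap of \<open>A\<close> with the
  other members is again a union of fewer than \<open>card F\<close> members of \<open>\<R>\<close>,
  but these do not form a subfamily of \<open>F\<close>; hence the induction on cardinality.\<close>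
proof (induction "card F" arbitrary: F rule: less_induct)
  case less
  interpret finite_measure \<mu> by fact
  show ?case
  proof (cases "F = {}")
    case True
    then show ?thesis using add[of "{}" "{}"] by simp
  next
    case False
    then obtain A G where F: "F = insert A G" "A \<notin> G" by (meson Set.set_insert all_not_in_conv)
    have G: "finite G" "G \<subseteq> \<R>" "A \<in> \<R>" "card G < card F" using less.prems F by auto
    let ?H = "(\<inter>) A ` G"
    have H: "finite ?H" "?H \<subseteq> \<R>" "card ?H < card F"
      using G R(2) card_image_le[of G "(\<inter>) A"] by (auto simp: Int_stable_def)
    have sets: "A \<in> sets \<mu>" "\<Union>G \<in> sets \<mu>"
      using G R(1) by (auto intro: sets.finite_Union)
    have "f (A \<union> \<Union>G) = f A + f (\<Union>G - A)"
      using add[of A "\<Union>G - A"] by simp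
    moreover have "f (\<Union>G) = f (A \<inter> \<Union>G) + f (\<Union>G - A)"
    proof -
      have "A \<inter> \<Union>G \<union> (\<Union>G - A) = \<Union>G" "A \<inter> \<Union>G \<inter> (\<Union>G - A) = {}" by blast+
      then show ?thesis using add[of "A \<inter> \<Union>G" "\<Union>G - A"] by metis
    qed
    moreover have "measure \<mu> (A \<union> \<Union>G) = measure \<mu> A + measure \<mu> (\<Union>G) - measure \<mu> (A \<inter> \<Union>G)"
      using sets by (simp add: measure_Un3 fmeasurable_eq_sets)
    moreover have "f (A \<inter> \<Union>G) = measure \<mu> (A \<inter> \<Union>G)"
      unfolding Int_Union by (rule less.hyps[OF H(3,1,2)])
    moreover have "f (\<Union>G) = measure \<mu> (\<Union>G)" by (rule less.hyps[OF G(4,1,2)])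
    moreover have "f A = measure \<mu> A" by (rule R(3)[OF G(3)])
    ultimately show ?thesis unfolding F(1) Union_insert by linarith
  qed
qed

text \<open>With equal masses the inequality is reversed on closed sets. Inner regularity of
  \<open>\<nu>\<close> by closed compact sets extends the reversed inequality to all Borel sets, and
  applying it to a set and its complement forces equality.\<close>

lemma radon_measures_eqI_open_le:
  fixes \<mu> \<nu> :: "'a::topological_space measure"
  assumes reg: "regular_space (euclidean :: 'a topology)"
    and \<mu>: "\<mu> \<in> radon_measures" and \<nu>: "\<nu> \<in> radon_measures"
    and le: "\<And>U. open U \<Longrightarrow> measure \<mu> U \<le> measure \<nu> U"
    and total: "measure \<mu> UNIV = measure \<nu> UNIV"
  shows "\<mu> = \<nu>"
proof -
  interpret M: finite_measure \<mu> by (rule radon_measures_finite[OF \<mu>])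
  interpret N: finite_measure \<nu> by (rule radon_measures_finite[OF \<nu>])
  note [simp] = radon_measures_sets[OF \<mu>] radon_measures_sets[OF \<nu>]
    radon_measures_space[OF \<mu>] radon_measures_space[OF \<nu>]
  have compl_M: "measure \<mu> (- B) = measure \<mu> UNIV - measure \<mu> B" if "B \<in> sets borel" for B
    using M.finite_measure_compl[of B] that by (simp add: Compl_eq_Diff_UNIV)
  have compl_N: "measure \<nu> (- B) = measure \<nu> UNIV - measure \<nu> B" if "B \<in> sets borel" for B
    using N.finite_measure_compl[of B] that by (simp add: Compl_eq_Diff_UNIV)
  have ge: "measure \<nu> B \<le> measure \<mu> B" if B: "B \<in> sets borel" for B
  proof (rule field_le_epsilon)
    fix e :: real assume "0 < e"
    then obtain K where K: "compact K" "closed K" "K \<subseteq> B" "measure \<nu> (B - K) < e"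
      using radon_measures_closed_compact[OF reg \<nu> B] by metis
    have "measure \<nu> K \<le> measure \<mu> K"
      using le[of "- K"] K(2) total compl_M[of K] compl_N[of K] by auto
    moreover have "measure \<mu> K \<le> measure \<mu> B"
      using K B by (intro M.finite_measure_mono) auto
    moreover have "measure \<nu> (B - K) = measure \<nu> B - measure \<nu> K"
      using K B by (intro N.finite_measure_Diff) auto
    ultimately show "measure \<nu> B \<le> measure \<mu> B + e" using K(4) by linarith
  qed
  show ?thesis
  proof (rule measure_eqI)
    fix B assume "B \<in> sets \<mu>"
    then have B: "B \<in> sets borel" by simp
    have "measure \<mu> B = measure \<nu> B"
      using ge[OF B] ge[OF borel_comp[OF B]] compl_M[OF B] compl_N[OF B] total by linarith
    then show "emeasure \<mu> B = emeasure \<nu> B"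
      by (simp add: M.emeasure_eq_measure N.emeasure_eq_measure)
  qed simp
qed

definition open_rectangles :: "('a::topological_space \<times> 'b::topological_space) set set" where
  "open_rectangles = {A \<times> C |A C. open A \<and> open C}"

lemma open_rectangles_open: "R \<in> open_rectangles \<Longrightarrow> open R"
  by (auto simp: open_rectangles_def open_Times)

text \<open>The open rectangles need not generate the Borel sets, so this is not an instance of the uniqueness
  theorem for measures on a generator.\<close>

lemma radon_measures_eqI_rectangles_le:
  fixes \<mu> \<nu> :: "('a::topological_space \<times> 'b::topological_space) measure"
  assumes reg: "regular_space (euclidean :: ('a \<times> 'b) topology)"
    and \<mu>: "\<mu> \<in> radon_measures" and \<nu>: "\<nu> \<in> radon_measures"
    and le: "\<And>F. finite F \<Longrightarrow> F \<subseteq> open_rectangles \<Longrightarrow> measure \<mu> (\<Union>F) \<le> measure \<nu> (\<Union>F)"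
    and total: "measure \<mu> UNIV = measure \<nu> UNIV"
  shows "\<mu> = \<nu>"
proof (rule radon_measures_eqI_open_le[OF reg \<mu> \<nu> _ total])
  interpret M: finite_measure \<mu> by (rule radon_measures_finite[OF \<mu>])
  interpret N: finite_measure \<nu> by (rule radon_measures_finite[OF \<nu>])
  note [simp] = radon_measures_sets[OF \<mu>] radon_measures_sets[OF \<nu>]
  fix U :: "('a \<times> 'b) set" assume U: "open U"
  show "measure \<mu> U \<le> measure \<nu> U"
  proof (rule field_le_epsilon)
    fix e :: real assume "0 < e"
    then obtain K where K: "compact K" "closed K" "K \<subseteq> U" "measure \<mu> (U - K) < e"
      using radon_measures_closed_compact[OF reg \<mu> borel_open[OF U]] by metis
    \<comment> \<open>Compactness of \<open>K\<close> places a finite union of open rectangles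
      between \<open>K\<close> and \<open>U\<close>, although \<open>U\<close> itself may be no
      countable union of rectangles.\<close>
    have "\<exists>\<D>\<subseteq>{R \<in> open_rectangles. R \<subseteq> U}. finite \<D> \<and> K \<subseteq> \<Union>\<D>"
    proof (rule compactE[OF K(1)])
      show "K \<subseteq> \<Union>{R \<in> open_rectangles. R \<subseteq> U}"
      proof
        fix z assume "z \<in> K"
        with K(3) have "z \<in> U" by blast
        from open_prod_elim[OF U this] obtain A B
          where AB: "open A" "open B" "z \<in> A \<times> B" "A \<times> B \<subseteq> U" by metis
        then have "A \<times> B \<in> open_rectangles" by (auto simp: open_rectangles_def)
        with AB(3,4) show "z \<in> \<Union>{R \<in> open_rectangles. R \<subseteq> U}" by (intro UnionI[of "A \<times> B"]) auto
      qed
      show "open R" if "R \<in> {R \<in> open_rectangles. R \<subseteq> U}" for R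
        using that open_rectangles_open by blast
    qed blast
    then obtain F where "F \<subseteq> {R \<in> open_rectangles. R \<subseteq> U}" and F: "finite F" "K \<subseteq> \<Union>F"
      by metis
    then have F': "F \<subseteq> open_rectangles" "\<Union>F \<subseteq> U" by auto
    then have "open (\<Union>F)" using open_rectangles_open by (intro open_Union) blast
    have "measure \<mu> U = measure \<mu> K + measure \<mu> (U - K)"
      using K U by (simp add: M.finite_measure_Diff)
    also have "measure \<mu> K \<le> measure \<mu> (\<Union>F)"
      using F \<open>open (\<Union>F)\<close> by (intro M.finite_measure_mono) auto
    also have "\<dots> \<le> measure \<nu> (\<Union>F)" using F F' by (intro le)
    also have "\<dots> \<le> measure \<nu> U"
      using F' U by (intro N.finite_measure_mono) auto
    finally show "measure \<mu> U \<le> measure \<nu> U + e" using K(4) by simp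
  qed
qed

section \<open>Gluing Radon measures along a common marginal\<close>

lemma continuous_on_triple_projections:
  "continuous_on UNIV (\<lambda>(x, y, s). (x, s))" "continuous_on UNIV (\<lambda>(x, y, s). (y, s))"
  "continuous_on UNIV (\<lambda>(x, y, s). x)" "continuous_on UNIV (\<lambda>(x, y, s). y)"
  unfolding case_prod_unfold by (intro continuous_intros)+

lemma regular_space_euclidean_prod:
  assumes "regular_space (euclidean :: 'a::topological_space topology)"
    "regular_space (euclidean :: 'b::topological_space topology)"
  shows "regular_space (euclidean :: ('a \<times> 'b) topology)"
  using assms regular_space_prod_topology[of "euclidean :: 'a topology" "euclidean :: 'b topology"]
  by simp

lemma radon_measures_gluing:
  fixes \<mu> :: "('x::topological_space \<times> 's::topological_space) measure"
    and \<nu> :: "('y::topological_space \<times> 's) measure"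
  assumes X: "regular_space (euclidean :: 'x topology)"
    and Y: "regular_space (euclidean :: 'y topology)"
    and S: "regular_space (euclidean :: 's topology)"
    and \<mu>: "\<mu> \<in> radon_measures" and \<nu>: "\<nu> \<in> radon_measures"
    and snd_eq: "distr \<mu> borel snd = distr \<nu> borel snd"
  obtains \<gamma> :: "('x \<times> 'y \<times> 's) measure" where "\<gamma> \<in> radon_measures"
    "distr \<gamma> borel (\<lambda>(x, y, s). (x, s)) = \<mu>" "distr \<gamma> borel (\<lambda>(x, y, s). (y, s)) = \<nu>"
proof -
  interpret M: finite_measure \<mu> by (rule radon_measures_finite[OF \<mu>])
  interpret N: finite_measure \<nu> by (rule radon_measures_finite[OF \<nu>])
  note [simp] = radon_measures_sets[OF \<mu>] radon_measures_sets[OF \<nu>]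
    radon_measures_space[OF \<mu>] radon_measures_space[OF \<nu>]
  have snd_meas: "snd \<in> measurable \<mu> borel" "snd \<in> measurable \<nu> borel"
    using borel_measurable_continuous_onI[OF continuous_on_snd[OF continuous_on_id]]
    by (simp_all cong: measurable_cong_sets)
  have marg: "measure \<mu> (UNIV \<times> C) = measure \<nu> (UNIV \<times> C)" if "C \<in> sets borel" for C
  proof -
    have "measure \<mu> (snd -` C) = measure \<nu> (snd -` C)"
      using arg_cong[OF snd_eq, of "\<lambda>M. measure M C"] that snd_meas
      by (simp add: measure_distr)
    then show ?thesis by (simp add: vimage_snd)
  qed
  obtain l :: "('x \<times> 'y \<times> 's) set \<Rightarrow> real" where l:
    "\<And>E. 0 \<le> l E" "\<And>E F. E \<inter> F = {} \<Longrightarrow> l (E \<union> F) = l E + l F"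
    "\<And>A C. A \<in> sets borel \<Longrightarrow> C \<in> sets borel \<Longrightarrow> l (A \<times> UNIV \<times> C) = measure \<mu> (A \<times> C)"
    "\<And>B C. B \<in> sets borel \<Longrightarrow> C \<in> sets borel \<Longrightarrow> l (UNIV \<times> B \<times> C) = measure \<nu> (B \<times> C)"
    using charge_gluing[OF _ M.finite_measure_axioms _ N.finite_measure_axioms marg] by auto
  have l_mono: "l E \<le> l F" if "E \<subseteq> F" for E F
    using l(2)[of E "F - E"] l(1)[of "F - E"] that by (simp add: Un_absorb1)
  interpret tight_charge l
  proof
    show "regular_space (euclidean :: ('x \<times> 'y \<times> 's) topology)"
      by (intro regular_space_euclidean_prod X Y S)
    fix e :: real assume e: "0 < e"
    obtain K where K: "compact K" "K \<in> sets borel" "measure \<mu> (UNIV - K) < e/2"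
      by (rule radon_measures_compact[OF \<mu>, of UNIV "e/2"]) (use e in auto)
    obtain L where L: "compact L" "L \<in> sets borel" "measure \<nu> (UNIV - L) < e/2"
      by (rule radon_measures_compact[OF \<nu>, of UNIV "e/2"]) (use e in auto)
    \<comment> \<open>The sides for \<open>x\<close> and \<open>s\<close> come from a compact set
      for \<open>\<mu>\<close>, the side for \<open>y\<close> from one for \<open>\<nu>\<close>.
      Taking closures makes them Borel, so that the values of \<open>l\<close> on rectangles
      apply.\<close>
    define A where "A = closure (fst ` K)"
    define B where "B = closure (fst ` L)"
    define C where "C = closure (snd ` K)"
    have "compact (fst ` K)" "compact (fst ` L)" "compact (snd ` K)"
      using K(1) L(1) by (auto intro!: compact_continuous_image continuous_on_fst continuous_on_snd)
    then have "compact (A \<times> B \<times> C)"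
      unfolding A_def B_def C_def
      by (intro compact_Times regular_compact_closure X Y S)
    moreover have "l (- (A \<times> B \<times> C)) \<le> e"
    proof -
      have borel: "A \<in> sets borel" "B \<in> sets borel" "C \<in> sets borel"
        by (auto simp: A_def B_def C_def)
      \<comment> \<open>A point outside the box either has \<open>(x, s)\<close> outside
        \<open>A \<times> C\<close>, a set controlled by \<open>\<mu>\<close>, or has
        \<open>y\<close> outside \<open>B\<close>, a set controlled by \<open>\<nu>\<close>.\<close>
      have "l (- (A \<times> B \<times> C)) \<le> l (- (A \<times> UNIV \<times> C) \<union> (A \<times> UNIV \<times> C \<inter> UNIV \<times> (- B) \<times> UNIV))"
        by (rule l_mono) auto
      also have "\<dots> = l (- (A \<times> UNIV \<times> C)) + l (A \<times> UNIV \<times> C \<inter> UNIV \<times> (- B) \<times> UNIV)"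
        by (rule l(2)) auto
      also have "\<dots> \<le> l (- (A \<times> UNIV \<times> C)) + l (UNIV \<times> (- B) \<times> UNIV)"
        by (intro add_left_mono l_mono) auto
      also have "l (- (A \<times> UNIV \<times> C)) \<le> e/2"
      proof -
        have "K \<subseteq> A \<times> C"
          using closure_subset[of "fst ` K"] closure_subset[of "snd ` K"] by (force simp: A_def C_def)
        then have "measure \<mu> K \<le> measure \<mu> (A \<times> C)"
          using borel by (intro M.finite_measure_mono) (auto intro: borel_Times)
        moreover have "measure \<mu> (UNIV - K) = measure \<mu> UNIV - measure \<mu> K"
          using M.finite_measure_compl[of K] K by simp
        moreover have "l UNIV = l (A \<times> UNIV \<times> C) + l (- (A \<times> UNIV \<times> C))"
          by (subst l(2)[symmetric]) (auto intro: arg_cong[of _ _ l])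
        ultimately show ?thesis
          using l(3)[of UNIV UNIV] l(3)[OF borel(1,3)] K(3) by simp
      qed
      also have "l (UNIV \<times> (- B) \<times> UNIV) \<le> e/2"
      proof -
        have "(- B) \<times> UNIV \<subseteq> UNIV - L"
          using closure_subset[of "fst ` L"] by (force simp: B_def)
        then have "measure \<nu> ((- B) \<times> UNIV) \<le> measure \<nu> (UNIV - L)"
          using L(2) by (intro N.finite_measure_mono) auto
        then show ?thesis
          using l(4)[OF borel_comp[OF borel(2)], of UNIV] L(3) by simp
      qed
      finally show ?thesis by simp
    qed
    ultimately show "\<exists>K. compact K \<and> l (- K) \<le> e" by blast
  qed (use l in auto)
  note [simp] = sets_radon_measure sets_eq_imp_space_eq[OF sets_radon_measure]
  \<comment> \<open>On finite unions of open rectangles the image measure is at most the charge of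
    the preimage, which is the value of \<open>\<rho>\<close>. As the total masses agree, nothing
    can be missing.\<close>
  have marginal: "distr radon_measure borel g = \<rho>"
    if g: "continuous_on UNIV g" and \<rho>: "\<rho> \<in> radon_measures"
      and reg: "regular_space (euclidean :: ('a \<times> 'b) topology)"
      and eq: "\<And>A C. A \<in> sets borel \<Longrightarrow> C \<in> sets borel \<Longrightarrow> l (g -` (A \<times> C)) = measure \<rho> (A \<times> C)"
    for g :: "'x \<times> 'y \<times> 's \<Rightarrow> 'a::topological_space \<times> 'b::topological_space" and \<rho>
  proof (rule radon_measures_eqI_rectangles_le[OF reg _ \<rho>])
    have "g \<in> borel_measurable borel" by (rule borel_measurable_continuous_onI[OF g])
    then have g_meas: "g \<in> measurable radon_measure borel"
      by (simp cong: measurable_cong_sets)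
    show "distr radon_measure borel g \<in> radon_measures"
      by (rule radon_measures_distr[OF reg radon_measure_in_radon_measures g])
    show "measure (distr radon_measure borel g) UNIV = measure \<rho> UNIV"
      using eq[of UNIV UNIV] by (simp add: measure_distr[OF g_meas] radon_measure_UNIV)
    fix F :: "('a \<times> 'b) set set" assume F: "finite F" "F \<subseteq> open_rectangles"
    have "open (\<Union>F)" using F(2) open_rectangles_open by (intro open_Union) blast
    have "measure (distr radon_measure borel g) (\<Union>F) = measure radon_measure (g -` \<Union>F)"
      using \<open>open (\<Union>F)\<close> by (simp add: measure_distr[OF g_meas])
    also have "\<dots> \<le> l (g -` \<Union>F)"
      using \<open>open (\<Union>F)\<close> g by (intro measure_radon_measure_open_le open_vimage)
    also have "\<dots> = measure \<rho> (\<Union>F)"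
    proof (rule additive_eq_measure_finite_Union[where f = "\<lambda>R. l (g -` R)" and \<R> = open_rectangles])
      show "l (g -` (A \<union> B)) = l (g -` A) + l (g -` B)" if "A \<inter> B = {}" for A B
        unfolding vimage_Un using that by (intro l(2)) auto
      show "finite_measure \<rho>" by (rule radon_measures_finite[OF \<rho>])
      show "open_rectangles \<subseteq> sets \<rho>"
        by (auto simp: radon_measures_sets[OF \<rho>] intro: borel_open open_rectangles_open)
      show "Int_stable (open_rectangles :: ('a \<times> 'b) set set)"
        unfolding Int_stable_def open_rectangles_def
        by (auto simp: Times_Int_Times) (metis open_Int)
      show "l (g -` R) = measure \<rho> R" if "R \<in> open_rectangles" for R
        using that eq by (auto simp: open_rectangles_def)
    qed (rule F)+
    finally show "measure (distr radon_measure borel g) (\<Union>F) \<le> measure \<rho> (\<Union>F)" .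
  qed
  show thesis
  proof (rule that[of radon_measure])
    show "radon_measure \<in> radon_measures" by (rule radon_measure_in_radon_measures)
    show "distr radon_measure borel (\<lambda>(x, y, s). (x, s)) = \<mu>"
    proof (rule marginal[OF _ \<mu> regular_space_euclidean_prod[OF X S]])
      fix A :: "'x set" and C :: "'s set" assume "A \<in> sets borel" "C \<in> sets borel"
      moreover have "(\<lambda>(x, y :: 'y, s). (x, s)) -` (A \<times> C) = A \<times> UNIV \<times> C" by auto
      ultimately show "l ((\<lambda>(x, y, s). (x, s)) -` (A \<times> C)) = measure \<mu> (A \<times> C)"
        by (simp add: l(3))
    qed (rule continuous_on_triple_projections)
    show "distr radon_measure borel (\<lambda>(x, y, s). (y, s)) = \<nu>"
    proof (rule marginal[OF _ \<nu> regular_space_euclidean_prod[OF Y S]])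
      fix A :: "'y set" and C :: "'s set" assume "A \<in> sets borel" "C \<in> sets borel"
      moreover have "(\<lambda>(x :: 'x, y, s). (y, s)) -` (A \<times> C) = UNIV \<times> A \<times> C" by auto
      ultimately show "l ((\<lambda>(x, y, s). (y, s)) -` (A \<times> C)) = measure \<nu> (A \<times> C)"
        by (simp add: l(4))
    qed (rule continuous_on_triple_projections)
  qed
qed

section \<open>Optimal pairs and plans\<close>

text \<open>Continuity from above at the empty set passes from \<open>\<pi>\<close> to the smaller
  \<open>m\<close>, and for a finite additive set function this amounts to countable additivity.
  Inner regularity passes down likewise.\<close>

lemma radon_measure_of_dominated_charge:
  fixes \<pi> :: "'a::topological_space measure" and m :: "'a set \<Rightarrow> real"
  assumes \<pi>: "\<pi> \<in> radon_measures"
    and nonneg: "\<And>B. B \<in> sets borel \<Longrightarrow> 0 \<le> m B"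
    and add: "\<And>A B. A \<in> sets borel \<Longrightarrow> B \<in> sets borel \<Longrightarrow> A \<inter> B = {} \<Longrightarrow> m (A \<union> B) = m A + m B"
    and le: "\<And>B. B \<in> sets borel \<Longrightarrow> m B \<le> measure \<pi> B"
  shows "\<exists>\<sigma>\<in>radon_measures. borel_le \<sigma> \<pi> \<and> (\<forall>B\<in>sets borel. measure \<sigma> B = m B)"
proof -
  interpret P: finite_measure \<pi> by (rule radon_measures_finite[OF \<pi>])
  interpret B: sigma_algebra UNIV "sets (borel :: 'a measure)"
    using sets.sigma_algebra_axioms[of "borel :: 'a measure"] by simp
  have pos: "positive (sets borel) (\<lambda>B. ennreal (m B))"
    using le[of "{}"] nonneg[of "{}"] by (simp add: positive_def)
  have "additive (sets borel) (\<lambda>B. ennreal (m B))"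
    unfolding additive_def using add nonneg by (auto simp: ennreal_plus[symmetric] simp del: ennreal_plus)
  then have ca: "countably_additive (sets borel) (\<lambda>B. ennreal (m B))"
  proof (rule B.empty_continuous_imp_countably_additive[OF pos])
    fix A :: "nat \<Rightarrow> 'a set" assume A: "range A \<subseteq> sets borel" "decseq A" "(\<Inter>i. A i) = {}"
    have "(\<lambda>i. measure \<pi> (A i)) \<longlonglongrightarrow> measure \<pi> (\<Inter>i. A i)"
      using A by (intro P.finite_Lim_measure_decseq) (auto simp: radon_measures_sets[OF \<pi>])
    then have lim: "(\<lambda>i. measure \<pi> (A i)) \<longlonglongrightarrow> 0" using A(3) by simp
    have "(\<lambda>i. m (A i)) \<longlonglongrightarrow> 0"
      by (intro tendsto_sandwich[OF _ _ tendsto_const lim] always_eventually allI) (use A nonneg le in auto)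
    then show "(\<lambda>i. ennreal (m (A i))) \<longlonglongrightarrow> 0"
      using tendsto_ennrealI by fastforce
  qed simp
  define \<sigma> where "\<sigma> = measure_of UNIV (sets borel) (\<lambda>B. ennreal (m B))"
  have sets: "sets \<sigma> = sets borel" unfolding \<sigma>_def by (metis sets.sets_measure_of_eq space_borel)
  have em: "emeasure \<sigma> B = ennreal (m B)" if "B \<in> sets borel" for B
    unfolding \<sigma>_def by (rule emeasure_measure_of_sigma[OF B.sigma_algebra_axioms pos ca that])
  have bl: "borel_le \<sigma> \<pi>"
    using le by (auto simp: borel_le_def em P.emeasure_eq_measure intro: ennreal_leI)
  have "\<sigma> \<in> radon_measures" by (rule radon_measures_borel_le[OF \<pi> sets bl])
  moreover have "measure \<sigma> B = m B" if "B \<in> sets borel" for B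
    using nonneg that by (simp add: measure_def em)
  ultimately show ?thesis using bl by blast
qed

lemma borel_le_measure:
  assumes "borel_le \<mu> \<nu>" "finite_measure \<nu>" "B \<in> sets borel"
  shows "measure \<mu> B \<le> measure \<nu> B"
  using assms finite_measure.emeasure_finite[OF assms(2)]
  by (simp add: borel_le_def measure_def enn2real_mono less_top[symmetric])

lemma radon_measures_borel_measurable:
  assumes "\<mu> \<in> radon_measures" "continuous_on UNIV f"
  shows "f \<in> measurable \<mu> borel"
  using borel_measurable_continuous_onI[OF assms(2)] radon_measures_sets[OF assms(1)]
  by (simp cong: measurable_cong_sets)

text \<open>Turns a marginal constraint into equations between values on cylinders, the form in
  which it is a closed condition on set functions.\<close>

lemma distr_fst_eq_iff:
  fixes \<mu> \<nu> :: "('a::topological_space \<times> 'b::topological_space) measure"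
  assumes "\<mu> \<in> radon_measures" "\<nu> \<in> radon_measures"
  shows "distr \<mu> borel fst = distr \<nu> borel fst \<longleftrightarrow>
    (\<forall>A\<in>sets borel. measure \<mu> (A \<times> UNIV) = measure \<nu> (A \<times> UNIV))"
proof -
  interpret M: finite_measure \<mu> by (rule radon_measures_finite[OF assms(1)])
  interpret N: finite_measure \<nu> by (rule radon_measures_finite[OF assms(2)])
  note meas = radon_measures_borel_measurable[OF _ continuous_on_fst[OF continuous_on_id]]
  have *: "emeasure (distr \<mu> borel fst) A = ennreal (measure \<mu> (A \<times> UNIV))"
    "emeasure (distr \<nu> borel fst) A = ennreal (measure \<nu> (A \<times> UNIV))" if "A \<in> sets borel" for A
    using assms that by (simp_all add: emeasure_distr meas radon_measures_space vimage_fst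
        M.emeasure_eq_measure N.emeasure_eq_measure)
  show ?thesis
  proof
    assume "distr \<mu> borel fst = distr \<nu> borel fst"
    then show "\<forall>A\<in>sets borel. measure \<mu> (A \<times> UNIV) = measure \<nu> (A \<times> UNIV)"
      using * by (metis ennreal_inj measure_nonneg)
  qed (intro measure_eqI, simp_all add: *)
qed

lemma distr_snd_eq_iff:
  fixes \<mu> \<nu> :: "('a::topological_space \<times> 'b::topological_space) measure"
  assumes "\<mu> \<in> radon_measures" "\<nu> \<in> radon_measures"
  shows "distr \<mu> borel snd = distr \<nu> borel snd \<longleftrightarrow>
    (\<forall>C\<in>sets borel. measure \<mu> (UNIV \<times> C) = measure \<nu> (UNIV \<times> C))"
proof -
  interpret M: finite_measure \<mu> by (rule radon_measures_finite[OF assms(1)])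
  interpret N: finite_measure \<nu> by (rule radon_measures_finite[OF assms(2)])
  note meas = radon_measures_borel_measurable[OF _ continuous_on_snd[OF continuous_on_id]]
  have *: "emeasure (distr \<mu> borel snd) A = ennreal (measure \<mu> (UNIV \<times> A))"
    "emeasure (distr \<nu> borel snd) A = ennreal (measure \<nu> (UNIV \<times> A))" if "A \<in> sets borel" for A
    using assms that by (simp_all add: emeasure_distr meas radon_measures_space vimage_snd
        M.emeasure_eq_measure N.emeasure_eq_measure)
  show ?thesis
  proof
    assume "distr \<mu> borel snd = distr \<nu> borel snd"
    then show "\<forall>A\<in>sets borel. measure \<mu> (UNIV \<times> A) = measure \<nu> (UNIV \<times> A)"
      using * by (metis ennreal_inj measure_nonneg)
  qed (intro measure_eqI, simp_all add: *)
qed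

lemma optimal_pair_exists:
  fixes \<pi>p \<pi>m :: "('x::topological_space \<times> 's::topological_space) measure"
  assumes p: "\<pi>p \<in> radon_measures" and m: "\<pi>m \<in> radon_measures"
  obtains \<sigma>p \<sigma>m where "optimal_pair \<pi>p \<pi>m \<sigma>p \<sigma>m"
proof -
  \<comment> \<open>Additivity is demanded on Borel sets only: \<open>measure \<tau>p\<close> of a
    competitor is \<open>0\<close> on non-Borel sets and so in general not additive on all
    subsets.\<close>
  define additive' where "additive' f \<longleftrightarrow> (\<forall>A B. A \<in> sets borel \<longrightarrow> B \<in> sets borel \<longrightarrow> A \<inter> B = {} \<longrightarrow>
      f (A \<union> B) = f A + f B)" for f :: "('x \<times> 's) set \<Rightarrow> real"
  \<comment> \<open>\<open>measure \<pi>p B = 0\<close> for non-Borel \<open>B\<close>, so the factors of \<open>K\<close> are trivial there.\<close>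
  define K where "K = PiE UNIV (\<lambda>B. {0..measure \<pi>p B}) \<times> PiE UNIV (\<lambda>B. {0..measure \<pi>m B})"
  define P where "P = {(f, g). additive' f \<and> additive' g \<and>
    (\<forall>A. A \<in> sets borel \<longrightarrow> f (A \<times> UNIV) = g (A \<times> UNIV)) \<and>
    (\<forall>C. C \<in> sets borel \<longrightarrow> f (UNIV \<times> C) = g (UNIV \<times> C))}"
  have c: "continuous_on UNIV (\<lambda>z. fst z B)" "continuous_on UNIV (\<lambda>z. snd z B)"
    for B :: "('x \<times> 's) set"
    by (rule continuous_on_compose2[OF continuous_on_product_coordinates]; auto intro: continuous_intros)+
  have "compact K" unfolding K_def by (intro compact_Times compact_PiE_UNIV) simp_all
  moreover have "closed P"
    unfolding P_def additive'_def case_prod_unfold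
    by (intro closed_Collect_conj closed_Collect_all closed_Collect_imp closed_Collect_eq
        open_Collect_const continuous_on_add c)
  ultimately have "compact (K \<inter> P)" by (rule compact_Int_closed)
  moreover have "(\<lambda>_. 0, \<lambda>_. 0) \<in> K \<inter> P" by (auto simp: K_def P_def additive'_def)
  then have "K \<inter> P \<noteq> {}" by blast
  \<comment> \<open>The total mass is the coordinate at \<open>UNIV\<close>, hence continuous for
    pointwise convergence.\<close>
  ultimately have "\<exists>z\<in>K \<inter> P. \<forall>w\<in>K \<inter> P. fst w UNIV \<le> fst z UNIV"
    by (rule continuous_attains_sup) (rule continuous_on_subset[OF c(1) subset_UNIV])
  then obtain z where z: "z \<in> K \<inter> P" "\<And>w. w \<in> K \<inter> P \<Longrightarrow> fst w UNIV \<le> fst z UNIV"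
    by metis
  obtain f g where fg: "z = (f, g)" by (cases z)
  have f: "0 \<le> f B" "f B \<le> measure \<pi>p B" and g: "0 \<le> g B" "g B \<le> measure \<pi>m B" for B
    using z(1) by (auto simp: fg K_def PiE_iff)
  have add: "f (A \<union> B) = f A + f B" "g (A \<union> B) = g A + g B"
    if "A \<in> sets borel" "B \<in> sets borel" "A \<inter> B = {}" for A B
    using z(1) that by (auto simp: fg P_def additive'_def)
  have eq: "A \<in> sets borel \<Longrightarrow> f (A \<times> UNIV) = g (A \<times> UNIV)"
    "C \<in> sets borel \<Longrightarrow> f (UNIV \<times> C) = g (UNIV \<times> C)" for A C
    using z(1) by (auto simp: fg P_def)
  have "\<exists>\<sigma>\<in>radon_measures. borel_le \<sigma> \<pi>p \<and> (\<forall>B\<in>sets borel. measure \<sigma> B = f B)"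
    by (rule radon_measure_of_dominated_charge[OF p]) (rule f add; assumption)+
  then obtain \<sigma>p where sp: "\<sigma>p \<in> radon_measures" "borel_le \<sigma>p \<pi>p"
      "\<And>B. B \<in> sets borel \<Longrightarrow> measure \<sigma>p B = f B"
    by metis
  have "\<exists>\<sigma>\<in>radon_measures. borel_le \<sigma> \<pi>m \<and> (\<forall>B\<in>sets borel. measure \<sigma> B = g B)"
    by (rule radon_measure_of_dominated_charge[OF m]) (rule g add; assumption)+
  then obtain \<sigma>m where sm: "\<sigma>m \<in> radon_measures" "borel_le \<sigma>m \<pi>m"
      "\<And>B. B \<in> sets borel \<Longrightarrow> measure \<sigma>m B = g B"
    by metis
  have "(\<sigma>p, \<sigma>m) \<in> admissible_pairs \<pi>p \<pi>m"
    using sp sm eq by (simp add: admissible_pairs_def distr_fst_eq_iff distr_snd_eq_iff borel_Times)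
  moreover have "measure \<tau>p UNIV \<le> measure \<sigma>p UNIV" if \<tau>: "(\<tau>p, \<tau>m) \<in> admissible_pairs \<pi>p \<pi>m" for \<tau>p \<tau>m
  proof -
    have rad: "\<tau>p \<in> radon_measures" "\<tau>m \<in> radon_measures"
      and le: "borel_le \<tau>p \<pi>p" "borel_le \<tau>m \<pi>m"
      using \<tau> by (auto simp: admissible_pairs_def)
    \<comment> \<open>Membership in the box \<open>K\<close> concerns every subset \<open>B\<close>;
      off the Borel sets both values are \<open>0\<close>.\<close>
    have le_p: "measure \<tau>p B \<le> measure \<pi>p B" for B
      using borel_le_measure[OF le(1) radon_measures_finite[OF p], of B] radon_measures_sets[OF rad(1)]
      by (cases "B \<in> sets borel") (simp_all add: measure_notin_sets)
    have le_m: "measure \<tau>m B \<le> measure \<pi>m B" for B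
      using borel_le_measure[OF le(2) radon_measures_finite[OF m], of B] radon_measures_sets[OF rad(2)]
      by (cases "B \<in> sets borel") (simp_all add: measure_notin_sets)
    have "additive' (measure \<tau>p)" "additive' (measure \<tau>m)"
      using rad by (auto simp: additive'_def radon_measures_sets
          intro!: finite_measure.finite_measure_Union[OF radon_measures_finite])
    then have "(measure \<tau>p, measure \<tau>m) \<in> K \<inter> P"
      using \<tau> rad le_p le_m
      by (auto simp: K_def P_def admissible_pairs_def distr_fst_eq_iff distr_snd_eq_iff)
    from z(2)[OF this] show ?thesis by (simp add: fg sp(3))
  qed
  ultimately have "optimal_pair \<pi>p \<pi>m \<sigma>p \<sigma>m"
    by (auto simp: optimal_pair_def is_arg_max_def not_less)
  then show thesis by (rule that)
qed

section \<open>Passage between plans and pairs\<close>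

lemma distr_triple_projections:
  fixes \<gamma> :: "('x::topological_space \<times> 'y::topological_space \<times> 's::topological_space) measure"
  assumes "\<gamma> \<in> radon_measures"
  shows "distr (distr \<gamma> borel (\<lambda>(x, y, s). (x, s))) borel fst = distr \<gamma> borel (\<lambda>(x, y, s). x)"
    "distr (distr \<gamma> borel (\<lambda>(x, y, s). (y, s))) borel fst = distr \<gamma> borel (\<lambda>(x, y, s). y)"
    "distr (distr \<gamma> borel (\<lambda>(x, y, s). (x, s))) borel snd
      = distr (distr \<gamma> borel (\<lambda>(x, y, s). (y, s))) borel snd"
proof -
  note proj = radon_measures_borel_measurable[OF assms continuous_on_triple_projections(1)]
    radon_measures_borel_measurable[OF assms continuous_on_triple_projections(2)]
  note fst = borel_measurable_continuous_onI[OF continuous_on_fst[OF continuous_on_id]]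
  note snd = borel_measurable_continuous_onI[OF continuous_on_snd[OF continuous_on_id]]
  show "distr (distr \<gamma> borel (\<lambda>(x, y, s). (x, s))) borel fst = distr \<gamma> borel (\<lambda>(x, y, s). x)"
    unfolding distr_distr[OF fst proj(1)] by (rule arg_cong[of _ _ "distr \<gamma> borel"]) auto
  show "distr (distr \<gamma> borel (\<lambda>(x, y, s). (y, s))) borel fst = distr \<gamma> borel (\<lambda>(x, y, s). y)"
    unfolding distr_distr[OF fst proj(2)] by (rule arg_cong[of _ _ "distr \<gamma> borel"]) auto
  show "distr (distr \<gamma> borel (\<lambda>(x, y, s). (x, s))) borel snd
      = distr (distr \<gamma> borel (\<lambda>(x, y, s). (y, s))) borel snd"
    unfolding distr_distr[OF snd proj(1)] distr_distr[OF snd proj(2)]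
    by (rule arg_cong[of _ _ "distr \<gamma> borel"]) auto
qed

text \<open>The common marginal on \<open>S\<close> is automatic, as both projections keep the third
  coordinate of one measure; the common marginal on \<open>X\<close> is the exchange condition of
  the plan.\<close>

lemma exchange_plan_marginals:
  fixes \<pi>p \<pi>m :: "('x::topological_space \<times> 's::topological_space) measure"
  assumes X: "regular_space (euclidean :: 'x topology)"
    and S: "regular_space (euclidean :: 's topology)"
    and \<gamma>: "\<gamma> \<in> exchange_plans \<pi>p \<pi>m"
  shows "(distr \<gamma> borel (\<lambda>(x, y, s). (x, s)), distr \<gamma> borel (\<lambda>(x, y, s). (y, s))) \<in> admissible_pairs \<pi>p \<pi>m"
proof -
  have rad: "\<gamma> \<in> radon_measures" using \<gamma> by (simp add: exchange_plans_def)
  note XS = regular_space_euclidean_prod[OF X S]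
  show ?thesis
    using \<gamma> radon_measures_distr[OF XS rad continuous_on_triple_projections(1)]
      radon_measures_distr[OF XS rad continuous_on_triple_projections(2)]
    by (simp only: admissible_pairs_def exchange_plans_def mem_Collect_eq case_prod_conv
        distr_triple_projections[OF rad] simp_thms)
qed

lemma measure_distr_UNIV:
  assumes "\<gamma> \<in> radon_measures" "continuous_on UNIV f"
  shows "measure (distr \<gamma> borel f) UNIV = measure \<gamma> UNIV"
  using radon_measures_borel_measurable[OF assms] by (simp add: measure_distr radon_measures_space[OF assms(1)])

text \<open>Gluing uses the common marginal on \<open>S\<close>; the exchange condition of the plan
  is then inherited from the common marginal of the pair on \<open>X\<close>.\<close>

lemma admissible_pair_plan:
  fixes \<pi>p \<pi>m :: "('x::topological_space \<times> 's::topological_space) measure"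
  assumes X: "regular_space (euclidean :: 'x topology)"
    and S: "regular_space (euclidean :: 's topology)"
    and \<sigma>: "(\<sigma>p, \<sigma>m) \<in> admissible_pairs \<pi>p \<pi>m"
  obtains \<gamma> where "\<gamma> \<in> exchange_plans \<pi>p \<pi>m"
    "distr \<gamma> borel (\<lambda>(x, y, s). (x, s)) = \<sigma>p" "distr \<gamma> borel (\<lambda>(x, y, s). (y, s)) = \<sigma>m"
proof -
  have "\<sigma>p \<in> radon_measures" "\<sigma>m \<in> radon_measures" "distr \<sigma>p borel snd = distr \<sigma>m borel snd"
    using \<sigma> by (auto simp: admissible_pairs_def)
  from radon_measures_gluing[OF X X S this] obtain \<gamma> :: "('x \<times> 'x \<times> 's) measure"
    where \<gamma>: "\<gamma> \<in> radon_measures"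
      "distr \<gamma> borel (\<lambda>(x, y, s). (x, s)) = \<sigma>p" "distr \<gamma> borel (\<lambda>(x, y, s). (y, s)) = \<sigma>m" .
  have "distr \<gamma> borel (\<lambda>(x, y, s). x) = distr \<sigma>p borel fst" "distr \<gamma> borel (\<lambda>(x, y, s). y) = distr \<sigma>m borel fst"
    unfolding \<gamma>(2,3)[symmetric] by (simp_all only: distr_triple_projections[OF \<gamma>(1)])
  then have "\<gamma> \<in> exchange_plans \<pi>p \<pi>m"
    using \<gamma> \<sigma> by (simp add: exchange_plans_def admissible_pairs_def)
  then show thesis using \<gamma> that by blast
qed

theorem theorem3p1:
  fixes \<pi>p \<pi>m :: "('x::topological_space \<times> 's::topological_space) measure"
  assumes "completely_regular_space (euclidean :: 'x topology)"
    and "completely_regular_space (euclidean :: 's topology)"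
    and "\<pi>p \<in> radon_measures"
    and "\<pi>m \<in> radon_measures"
  shows "(\<exists>\<gamma> \<sigma>p \<sigma>m. optimal_plan \<pi>p \<pi>m \<gamma> \<and> optimal_pair \<pi>p \<pi>m \<sigma>p \<sigma>m \<and>
            measure \<gamma> UNIV = measure \<sigma>p UNIV) \<and>
         (\<forall>\<sigma>p \<sigma>m. optimal_pair \<pi>p \<pi>m \<sigma>p \<sigma>m \<longrightarrow>
            (\<exists>\<gamma>. optimal_plan \<pi>p \<pi>m \<gamma> \<and>
               distr \<gamma> borel (\<lambda>(x, y, s). (x, s)) = \<sigma>p \<and>
               distr \<gamma> borel (\<lambda>(x, y, s). (y, s)) = \<sigma>m))"
proof -
  note X = completely_regular_imp_regular_space[OF assms(1)]
  note S = completely_regular_imp_regular_space[OF assms(2)]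
  have mass: "measure (distr \<gamma> borel (\<lambda>(x, y, s). (x, s))) UNIV = measure \<gamma> UNIV"
    if "\<gamma> \<in> exchange_plans \<pi>p \<pi>m" for \<gamma>
    using that by (intro measure_distr_UNIV continuous_on_triple_projections) (simp add: exchange_plans_def)
  have plan: "\<exists>\<gamma>. optimal_plan \<pi>p \<pi>m \<gamma> \<and> distr \<gamma> borel (\<lambda>(x, y, s). (x, s)) = \<sigma>p \<and>
      distr \<gamma> borel (\<lambda>(x, y, s). (y, s)) = \<sigma>m \<and> measure \<gamma> UNIV = measure \<sigma>p UNIV"
    if opt: "optimal_pair \<pi>p \<pi>m \<sigma>p \<sigma>m" for \<sigma>p \<sigma>m
  proof -
    have adm: "(\<sigma>p, \<sigma>m) \<in> admissible_pairs \<pi>p \<pi>m"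
      and max: "\<And>\<tau>p \<tau>m. (\<tau>p, \<tau>m) \<in> admissible_pairs \<pi>p \<pi>m \<Longrightarrow> measure \<tau>p UNIV \<le> measure \<sigma>p UNIV"
      using opt by (auto simp: optimal_pair_def is_arg_max_def not_less)
    obtain \<gamma> where \<gamma>: "\<gamma> \<in> exchange_plans \<pi>p \<pi>m"
      "distr \<gamma> borel (\<lambda>(x, y, s). (x, s)) = \<sigma>p" "distr \<gamma> borel (\<lambda>(x, y, s). (y, s)) = \<sigma>m"
      by (rule admissible_pair_plan[OF X S adm])
    have "measure \<gamma>' UNIV \<le> measure \<gamma> UNIV" if "\<gamma>' \<in> exchange_plans \<pi>p \<pi>m" for \<gamma>'
      using max[OF exchange_plan_marginals[OF X S that]] mass[OF that] mass[OF \<gamma>(1)] \<gamma>(2) by simp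
    then have "optimal_plan \<pi>p \<pi>m \<gamma>"
      using \<gamma>(1) by (auto simp: optimal_plan_def is_arg_max_def not_less)
    with \<gamma> mass[OF \<gamma>(1)] show ?thesis by auto
  qed
  \<comment> \<open>Existence of an optimal plan takes no compactness argument of its own: lifting
    one optimal pair yields a plan of the same mass that is optimal.\<close>
  obtain \<sigma>p \<sigma>m where "optimal_pair \<pi>p \<pi>m \<sigma>p \<sigma>m"
    using optimal_pair_exists[OF assms(3,4)] .
  with plan show ?thesis by blast
qed

end
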